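(* Let $f$ be a meromorphic function on $\mathbb{C}$ and let $\mathcal{C}\subset\mathbb{R}^2\cong\mathbb{C}$ be an irreducible real algebraic curve. Assume that there exist a slit $\gamma$ and a branch of the Schwarz function $S_{\mathcal{C}}$ of $\mathcal{C}$ that is analytic in $\mathbb{C}\setminus\gamma$ and satisfies $$\lim_{z\to\infty,\ z\notin\gamma} S_{\mathcal{C}}(z)=c$$ for some finite $c\in\mathbb{C}$. Let $A$ be a non-degenerate continuum contained in $\mathcal{C}$. If $f(A)$ is contained in a real algebraic curve $\mathcal{C}'\subset\mathbb{R}^2$, then $f$ is a rational function.
   Context: The plane $\mathbb{R}^2$ is identified with $\mathbb{C}$. A real algebraic curve is the zero set in $\mathbb{R}^2$ of a non-constant real polynomial $P(x,y)$; it is irreducible if $P$ can be taken irreducible. A non-degenerate continuum is a compact connected set with more than one point. Schwarz function: if $\Gamma$ is a non-singular real-analytic arc given near each of its points as $F(z,\bar z)=0$ with $F(z,w)$ holomorphic in two variables and $\partial F/\partial w\neq 0$, the implicit function theorem gives a unique holomorphic function $S_\Gamma$ in a neighborhood of $\Gamma$ with $F(z,S_\Gamma(z))\equiv 0$ and $S_\Gamma(z)=\bar z$ for $z\in\Gamma$. For a real algebraic curve $\mathcal{C}$ written as $Q(z,\bar z)=0$ with $Q\in\mathbb{C}[z,w]$ (obtained by substituting $x=(z+\bar z)/2$, $y=(z-\bar z)/(2i)$), $S_{\mathcal{C}}$ is the (multivalued) algebraic function $w=w(z)$ defined by $Q(z,w)=0$, obtained by analytic continuation of the Schwarz function of a non-singular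 arc of $\mathcal{C}$. A slit is a simple curve $\gamma:[0,\infty)\to\mathbb{C}$ with $\gamma(t)\to\infty$ as $t\to\infty$, chosen so that branches of the algebraic function are single-valued analytic in $\mathbb{C}\setminus\gamma$. *)

theory Defs
  imports "HOL-Complex_Analysis.Complex_Analysis" "HOL-Computational_Algebra.Computational_Algebra"
begin

text \<open>A real polynomial in two variables x, y is represented as an element of
  (real poly) poly: the outer variable is y, the coefficients are polynomials in x.\<close>

definition eval2 :: "'a::comm_ring_1 poly poly \<Rightarrow> 'a \<Rightarrow> 'a \<Rightarrow> 'a" where
  "eval2 P x y = poly (poly P [:y:]) x"

definition nonconst2 :: "real poly poly \<Rightarrow> bool" where
  "nonconst2 P \<longleftrightarrow> \<not> (\<exists>c. P = [:[:c:]:])"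

definition zero_set2 :: "real poly poly \<Rightarrow> complex set" where
  "zero_set2 P = {z. eval2 P (Re z) (Im z) = 0}"

definition real_alg_curve :: "complex set \<Rightarrow> bool" where
  "real_alg_curve C \<longleftrightarrow> (\<exists>P. nonconst2 P \<and> C = zero_set2 P)"

definition irreducible_real_alg_curve :: "complex set \<Rightarrow> bool" where
  "irreducible_real_alg_curve C \<longleftrightarrow> (\<exists>P. irreducible P \<and> nonconst2 P \<and> C = zero_set2 P)"

text \<open>Q(z,w) = P((z+w)/2, (z-w)/(2i)), so that Q(z, conj z) = P(Re z, Im z).\<close>
definition schwarz_poly :: "real poly poly \<Rightarrow> complex \<Rightarrow> complex \<Rightarrow> complex" where
  "schwarz_poly P z w =
     eval2 (map_poly (map_poly complex_of_real) P) ((z + w) / 2) ((z - w) / (2 * \<i>))"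

definition slit :: "(real \<Rightarrow> complex) \<Rightarrow> bool" where
  "slit \<gamma> \<longleftrightarrow> continuous_on {0..} \<gamma> \<and> inj_on \<gamma> {0..} \<and> filterlim \<gamma> at_infinity at_top"

definition schwarz_branch :: "real poly poly \<Rightarrow> (real \<Rightarrow> complex) \<Rightarrow> (complex \<Rightarrow> complex) \<Rightarrow> bool" where
  "schwarz_branch P \<gamma> S \<longleftrightarrow>
     S holomorphic_on (- (\<gamma> ` {0..})) \<and> (\<forall>z \<in> - (\<gamma> ` {0..}). schwarz_poly P z (S z) = 0)"

definition nondegenerate_continuum :: "complex set \<Rightarrow> bool" where
  "nondegenerate_continuum A \<longleftrightarrow> compact A \<and> connected A \<and> (\<exists>a\<in>A. \<exists>b\<in>A. a \<noteq> b)"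

text \<open>f is rational: agrees with p/q wherever f is analytic and q does not vanish
  (values of a meromorphic function at its singularities are irrelevant).\<close>
definition is_rational_fun :: "(complex \<Rightarrow> complex) \<Rightarrow> bool" where
  "is_rational_fun f \<longleftrightarrow> (\<exists>p q. q \<noteq> 0 \<and>
     (\<forall>z. f analytic_on {z} \<and> poly q z \<noteq> 0 \<longrightarrow> f z = poly p z / poly q z))"

end

theory Submission
  imports Defs "HOL-Computational_Algebra.Field_as_Ring"
begin

text \<open>Write \<open>f = a / b\<close> with entire \<open>a\<close>, \<open>b\<close> without common zeros, and let \<open>a* w = cnj (a (cnj w))\<close>,
  likewise \<open>b*\<close>. Clearing denominators in the equation of \<open>C'\<close> turns \<open>f(A) \<subseteq> C'\<close> into
  \<open>h(z, cnj z) = 0\<close> on \<open>A\<close>, where \<open>h(z, w)\<close> is the sum of \<open>a(z)^i b(z)^(M - i) G\<^sub>i(w)\<close> with \<open>G\<^sub>i\<close>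
  homogeneous in \<open>a*\<close>, \<open>b*\<close>; after division by a power of \<open>w - c\<close> not all \<open>G\<^sub>i(c)\<close> vanish.

  The branches \<open>w(z)\<close> of \<open>P = 0\<close> along which \<open>h\<close> vanishes identically form a locally constant family
  of roots, so the elementary symmetric functions of these roots are holomorphic off a finite set. They grow at most
  polynomially, hence by Liouville they are rational, and the family is cut out by a polynomial
  \<open>B(z, w)\<close>. This \<open>B\<close> vanishes at the points \<open>(z, cnj z)\<close> with \<open>z \<in> A\<close>, so the
  irreducible \<open>P\<close> divides it: \<open>h\<close> vanishes on every branch, in particular \<open>h(z, S z) = 0\<close>.

  Letting \<open>z\<close> tend to infinity off the slit, \<open>f(z)\<close> is almost a root of the nonzero polynomial
  with coefficients \<open>G\<^sub>i(c)\<close>, so \<open>f\<close> omits a disc there. The complement of the slit is dense, so \<open>f\<close>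
  omits the disc in a full neighbourhood of infinity and is therefore rational.\<close>

section \<open>Bivariate polynomials\<close>

lemma eval2_0 [simp]: "eval2 0 x y = 0"
  by (simp add: eval2_def)

lemma eval2_pCons [simp]: "eval2 (pCons p B) x y = poly p x + y * eval2 B x y"
  by (simp add: eval2_def)

lemma eval2_add [simp]: "eval2 (A + B) x y = eval2 A x y + eval2 B x y"
  by (simp add: eval2_def)

lemma eval2_mult [simp]: "eval2 (A * B) x y = eval2 A x y * eval2 B x y"
  by (simp add: eval2_def)

lemma eval2_smult [simp]: "eval2 (smult p A) x y = poly p x * eval2 A x y"
  by (simp add: eval2_def)

text \<open>Fixing the inner variable gives a univariate polynomial over the ground ring, to which
  root counting and factorization apply.\<close>

definition slice :: "'a::comm_ring_1 poly poly \<Rightarrow> 'a \<Rightarrow> 'a poly" where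
  "slice Q x = map_poly (\<lambda>p. poly p x) Q"

lemma poly_slice [simp]: "poly (slice Q x) y = eval2 Q x y"
  by (induction Q) (auto simp: slice_def map_poly_pCons)

lemma coeff_slice [simp]: "coeff (slice Q x) j = poly (coeff Q j) x"
  by (simp add: slice_def coeff_map_poly)

lemma pderiv_slice: "pderiv (slice Q x) = slice (pderiv Q) x"
  for Q :: "'a::idom poly poly"
  by (rule poly_eqI) (simp add: coeff_pderiv)

lemma eval2_eq_0_imp:
  fixes Q :: "'a::{idom,ring_char_0} poly poly"
  assumes "\<And>x y. eval2 Q x y = 0"
  shows "Q = 0"
proof -
  have "slice Q x = 0" for x
    using assms by (intro iffD1[OF poly_all_0_iff_0]) auto
  hence "poly (coeff Q j) x = 0" for x j
    by (metis coeff_0 coeff_slice)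
  hence "coeff Q j = 0" for j
    using poly_all_0_iff_0 by blast
  thus ?thesis
    by (simp add: poly_eq_iff)
qed

text \<open>A vertical line inside the curve makes \<open>x\<close> a root of every coefficient,
  hence gives a linear factor.\<close>

lemma slice_eq_0_imp_dvd:
  fixes Q :: "'a::idom poly poly"
  assumes "slice Q x = 0"
  shows "[:[:-x, 1:]:] dvd Q"
proof -
  have "poly (coeff Q j) x = 0" for j
    using assms by (metis coeff_0 coeff_slice)
  thus ?thesis
    unfolding const_poly_dvd_iff poly_eq_0_iff_dvd by blast
qed

text \<open>Provides the linear changes of coordinates between \<open>(x, y)\<close> and
  \<open>(z, w)\<close>. Only values of the composite matter later, so its mere existence is
  enough.\<close>

lemma eval2_compose_ex:
  "\<exists>Q. \<forall>x y. eval2 Q x y = eval2 M (eval2 G x y) (eval2 H x y)"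
proof (induction M)
  case 0
  show ?case by (auto intro: exI[of _ 0])
next
  case (pCons p M)
  then obtain Q where Q: "\<And>x y. eval2 Q x y = eval2 M (eval2 G x y) (eval2 H x y)"
    by blast
  have "\<exists>R. \<forall>x y. eval2 R x y = poly p (eval2 G x y)"
  proof (induction p)
    case 0
    show ?case by (auto intro: exI[of _ 0])
  next
    case (pCons a p)
    then obtain R where "\<And>x y. eval2 R x y = poly p (eval2 G x y)"
      by blast
    thus ?case by (intro exI[of _ "[:[:a:]:] + G * R"]) auto
  qed
  then obtain R where "\<And>x y. eval2 R x y = poly p (eval2 G x y)"
    by blast
  with Q show ?case by (intro exI[of _ "R + H * Q"]) auto
qed

section \<open>Complexification of real polynomials\<close>

abbreviation complexify :: "real poly poly \<Rightarrow> complex poly poly" where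
  "complexify \<equiv> map_poly (map_poly complex_of_real)"

lemma complexify_mult: "complexify (P * Q) = complexify P * complexify Q"
proof -
  have "map_poly complex_of_real (p * q) = map_poly complex_of_real p * map_poly complex_of_real q" for p q
    by (rule poly_eqI) (simp add: coeff_map_poly coeff_mult)
  moreover have "map_poly complex_of_real (sum f I) = (\<Sum>i\<in>I. map_poly complex_of_real (f i))" for f and I :: "nat set"
    by (rule poly_eqI) (simp add: coeff_map_poly coeff_sum)
  ultimately show ?thesis
    by (intro poly_eqI) (simp add: coeff_map_poly coeff_mult)
qed

lemma poly_map_of_real: "poly (map_poly complex_of_real p) (of_real x) = of_real (poly p x)"
  by (induction p) (auto simp: map_poly_pCons)

lemma eval2_complexify_of_real [simp]:
  "eval2 (complexify P) (of_real x) (of_real y) = complex_of_real (eval2 P x y)"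
  by (induction P) (auto simp: map_poly_pCons poly_map_of_real)

lemma real_imaginary_decomposition:
  obtains G1 G2 where "Q = complexify G1 + [:[:\<i>:]:] * complexify G2"
proof
  show "Q = complexify (map_poly (map_poly Re) Q) + [:[:\<i>:]:] * complexify (map_poly (map_poly Im) Q)"
    by (intro poly_eqI) (simp add: coeff_map_poly complex_eq)
qed

lemma schwarz_poly_eval2:
  obtains Q where "\<And>z w. schwarz_poly P z w = eval2 Q z w"
proof -
  have "schwarz_poly P z w = eval2 (complexify P) (eval2 [:[:0,1/2:],[:1/2:]:] z w)
          (eval2 [:[:0,1/(2*\<i>):],[:-1/(2*\<i>):]:] z w)" for z w
    by (simp add: schwarz_poly_def diff_divide_distrib add_divide_distrib algebra_simps)
  thus ?thesis
    using eval2_compose_ex that by metis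
qed

lemma schwarz_poly_cnj: "schwarz_poly P z (cnj z) = of_real (eval2 P (Re z) (Im z))"
proof -
  have "(z + cnj z) / 2 = of_real (Re z)" "(z - cnj z) / (2 * \<i>) = of_real (Im z)"
    by (simp_all add: complex_eq_iff)
  thus ?thesis
    by (simp add: schwarz_poly_def)
qed

text \<open>On the real plane, where \<open>w = cnj z\<close>, the polynomial \<open>Q\<close> takes
  the values of \<open>P\<close>.\<close>

lemma schwarz_eval2_nonzero:
  assumes "P \<noteq> 0" "\<And>z w. schwarz_poly P z w = eval2 Q z w"
  shows "Q \<noteq> 0"
proof
  assume "Q = 0"
  hence "schwarz_poly P (Complex x y) (cnj (Complex x y)) = 0" for x y
    using assms by simp
  hence "eval2 P x y = 0" for x y
    unfolding schwarz_poly_cnj by simp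
  thus False
    using assms eval2_eq_0_imp by blast
qed

section \<open>Elimination of the outer variable\<close>

text \<open>A nonzero element of least degree in the ideal generated by \<open>A\<close> and \<open>B\<close> divides both up to
  constants, by pseudo-division.\<close>
lemma gcd_up_to_constants:
  fixes A B :: "'a::idom poly"
  assumes "A \<noteq> 0"
  obtains U V g q1 q2 e1 e2 where "g = U * A + V * B" "g \<noteq> 0"
    "smult e1 A = g * q1" "smult e2 B = g * q2" "e1 \<noteq> 0" "e2 \<noteq> 0"
proof -
  define I where "I g \<longleftrightarrow> g \<noteq> 0 \<and> (\<exists>U V. g = U * A + V * B)" for g
  have "I A"
    unfolding I_def using assms by (auto intro: exI[of _ 1] exI[of _ 0])
  then obtain g where g: "I g" and min: "\<And>h. I h \<Longrightarrow> degree g \<le> degree h"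
    using arg_min_natI[of I A degree] arg_min_nat_le[of I _ degree] by metis
  obtain U V where gUV: "g = U * A + V * B" and "g \<noteq> 0"
    using g unfolding I_def by blast
  have div: "\<exists>e q. e \<noteq> 0 \<and> smult e C = g * q" if "C = U' * A + V' * B" for C U' V'
  proof -
    obtain a q where aq: "a \<noteq> 0" "smult a C = g * q + pseudo_mod C g"
      using pseudo_mod(1)[OF \<open>g \<noteq> 0\<close>] by blast
    define r where "r = pseudo_mod C g"
    have "r = smult a C - g * q"
      using aq r_def by simp
    also have "\<dots> = (smult a U' - q * U) * A + (smult a V' - q * V) * B"
      unfolding that gUV by (simp add: algebra_simps smult_add_right)
    finally have "r = 0 \<or> I r"
      unfolding I_def by blast
    hence "r = 0"
      using min[of r] pseudo_mod(2)[OF \<open>g \<noteq> 0\<close>, of C] r_def by auto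
    thus ?thesis using aq r_def by auto
  qed
  obtain e1 q1 where "e1 \<noteq> 0" "smult e1 A = g * q1"
    using div[of A 1 0] by auto
  moreover obtain e2 q2 where "e2 \<noteq> 0" "smult e2 B = g * q2"
    using div[of B 0 1] by auto
  ultimately show ?thesis
    using that gUV \<open>g \<noteq> 0\<close> by blast
qed

text \<open>The gcd \<open>g\<close> up to constants divides a constant multiple of
  \<open>P\<close>. It is not divisible by \<open>P\<close>, or else \<open>P\<close> would divide
  \<open>G\<close>. So \<open>P\<close> divides the cofactor \<open>q1\<close>, and comparing
  degrees leaves \<open>g\<close> constant in the outer variable.\<close>

lemma prime_elem_elimination:
  fixes P G :: "'a::idom poly"
  assumes "prime_elem P" "\<not> P dvd G"
  obtains U V d where "[:d:] = U * P + V * G" "d \<noteq> 0"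
proof (cases "degree P = 0")
  case True
  then obtain d where "P = [:d:]"
    by (auto elim: degree_eq_zeroE)
  moreover have "P \<noteq> 0" using assms by auto
  ultimately show ?thesis
    using that[of d 1 0] by auto
next
  case False
  have P0: "P \<noteq> 0" using assms by auto
  then obtain U V g q1 q2 e1 e2 where g: "g = U * P + V * G" "g \<noteq> 0"
    "smult e1 P = g * q1" "smult e2 G = g * q2" "e1 \<noteq> 0" "e2 \<noteq> 0"
    by (rule gcd_up_to_constants[of P G])
  have const: "\<not> P dvd [:e:]" if "e \<noteq> 0" for e
    using dvd_imp_degree_le[of P "[:e:]"] that False by auto
  have "P dvd g * q1"
    by (metis g(3) dvd_smult dvd_refl)
  moreover have "\<not> P dvd g"
  proof
    assume "P dvd g"
    hence "P dvd [:e2:] * G"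
      using g(4) by simp
    thus False
      using assms const g by (metis prime_elem_dvd_mult_iff)
  qed
  ultimately have "P dvd q1"
    using assms by (simp add: prime_elem_dvd_mult_iff)
  then obtain s where "q1 = P * s" by (rule dvdE)
  with g(3) have "P * [:e1:] = P * (g * s)"
    by (simp add: mult_ac)
  hence "[:e1:] = g * s"
    using P0 by (metis mult_cancel_left)
  hence "degree g + degree s = 0"
    using g by (metis degree_mult_eq degree_pCons_0 mult_zero_right pCons_eq_0_iff)
  then obtain d where "g = [:d:]"
    by (auto elim: degree_eq_zeroE)
  thus ?thesis using that[of d U V] g(1,2) by auto
qed

text \<open>Factorization into primes, skipping the prime factors that lie in the coefficient
  ring.\<close>

lemma prime_divisor_of_positive_degree:
  fixes g :: "complex poly poly"
  assumes "degree g > 0"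
  obtains p where "prime_elem p" "degree p > 0" "p dvd g"
proof -
  have "degree g > 0 \<longrightarrow> (\<exists>p. prime_elem p \<and> degree p > 0 \<and> p dvd g)"
  proof (induction g rule: prime_divisors_induct)
    case (unit x)
    thus ?case
      by (auto simp: is_unit_poly_iff)
  next
    case (factor p x)
    show ?case
    proof (cases "degree p > 0")
      case True
      thus ?thesis using factor by (auto intro!: exI[of _ p])
    next
      case False
      hence "degree (p * x) > 0 \<Longrightarrow> degree x > 0"
        using degree_mult_le[of p x] by auto
      thus ?thesis using factor by (auto intro: dvd_mult)
    qed
  qed auto
  thus ?thesis using assms that by blast
qed

text \<open>A polynomial of least degree vanishing on the zero set of \<open>Q\<close> cannot have a repeated factor
  of positive degree.\<close>
lemma separable_model:
  fixes Q :: "complex poly poly"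
  assumes "Q \<noteq> 0"
  obtains R U V d where "R \<noteq> 0" "\<And>z w. eval2 Q z w = 0 \<Longrightarrow> eval2 R z w = 0"
    "[:d:] = U * R + V * pderiv R" "d \<noteq> 0"
proof -
  define good where "good R \<longleftrightarrow> R \<noteq> 0 \<and> (\<forall>z w. eval2 Q z w = 0 \<longrightarrow> eval2 R z w = 0)" for R
  have "good Q" using assms good_def by auto
  then obtain R where R: "good R" and min: "\<And>h. good h \<Longrightarrow> degree R \<le> degree h"
    using arg_min_natI[of good Q degree] arg_min_nat_le[of good _ degree] by metis
  have R0: "R \<noteq> 0" using R good_def by auto
  then obtain U V g q1 q2 e1 e2 where g: "g = U * R + V * pderiv R" "g \<noteq> 0"
    "smult e1 R = g * q1" "smult e2 (pderiv R) = g * q2" "e1 \<noteq> 0" "e2 \<noteq> 0"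
    by (rule gcd_up_to_constants[of R "pderiv R"])
  have "degree g = 0"
  proof (rule ccontr)
    assume "degree g \<noteq> 0"
    then obtain p where p: "prime_elem p" "degree p > 0" "p dvd g"
      using prime_divisor_of_positive_degree by blast
    have const: "\<not> p dvd [:e:]" if "e \<noteq> 0" for e
      using dvd_imp_degree_le[of p "[:e:]"] that p by auto
    have "p dvd [:e1:] * R" "p dvd [:e2:] * pderiv R"
      using p g by simp_all
    hence "p dvd R" "p dvd pderiv R"
      using p const g by (metis prime_elem_dvd_mult_iff)+
    then obtain s where s: "R = p * s" by (elim dvdE)
    have "p dvd s * pderiv p"
      using \<open>p dvd pderiv R\<close> unfolding s pderiv_mult
      by (simp add: dvd_add_right_iff)
    \<comment> \<open>In characteristic 0 the derivative of \<open>p\<close> is nonzero and has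
      smaller degree.\<close>
    moreover have "\<not> p dvd pderiv p"
      using p(2) dvd_imp_degree_le[of p "pderiv p"] by (auto simp: pderiv_eq_0_iff degree_pderiv)
    ultimately have "p dvd s"
      using p(1) by (simp add: prime_elem_dvd_mult_iff)
    then obtain t where t: "s = p * t" by (elim dvdE)
    have nz: "p \<noteq> 0" "t \<noteq> 0" using R0 s t by auto
    \<comment> \<open>Since \<open>R = p * (p * t)\<close>, dropping one copy of \<open>p\<close>
      leaves the zero set unchanged but lowers the degree.\<close>
    have "good (p * t)"
      using R s t nz unfolding good_def by auto
    hence "degree R \<le> degree (p * t)" by (rule min)
    thus False
      using nz p(2) unfolding s t by (simp add: degree_mult_eq)
  qed
  then obtain d where "g = [:d:]"
    by (auto elim: degree_eq_zeroE)
  thus ?thesis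
    using that[of R d U V] R g good_def by auto
qed

text \<open>Elimination leaves finitely many abscissas. Over each of them there are finitely many
  points, for otherwise a vertical line would divide both polynomials. The irreducible
  \<open>P\<close> would then be that line up to a unit and would divide \<open>G\<close>.\<close>

lemma finite_common_zeros:
  fixes P G :: "real poly poly"
  assumes "irreducible P" "\<not> P dvd G"
  shows "finite {z. eval2 P (Re z) (Im z) = 0 \<and> eval2 G (Re z) (Im z) = 0}"
proof -
  have "prime_elem P"
    using assms(1) by (rule irreducible_imp_prime_elem)
  then obtain U V d where d: "[:d:] = U * P + V * G" "d \<noteq> 0"
    using assms(2) by (rule prime_elem_elimination)
  define Y where "Y x = {y. eval2 P x y = 0 \<and> eval2 G x y = 0}" for x
  have "finite (Y x)" for x
  proof (rule ccontr)
    assume "infinite (Y x)"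
    hence "slice P x = 0" "slice G x = 0"
      using poly_roots_finite[of "slice P x"] poly_roots_finite[of "slice G x"]
      by (auto simp: Y_def intro: finite_subset[rotated])
    hence L: "[:[:-x, 1:]:] dvd P" "[:[:-x, 1:]:] dvd G"
      by (auto intro: slice_eq_0_imp_dvd)
    have "\<not> [:[:-x, 1:]:] dvd 1"
      by (simp add: is_unit_const_poly_iff is_unit_poly_iff)
    hence "P dvd [:[:-x, 1:]:]"
      using L(1) assms(1) by (metis irreducibleD')
    thus False
      using L(2) assms(2) dvd_trans by blast
  qed
  moreover have "finite {x. poly d x = 0}"
    using d poly_roots_finite by blast
  ultimately have "finite (\<Union>x\<in>{x. poly d x = 0}. Complex x ` Y x)"
    by blast
  moreover have "{z. eval2 P (Re z) (Im z) = 0 \<and> eval2 G (Re z) (Im z) = 0} \<subseteq>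
      (\<Union>x\<in>{x. poly d x = 0}. Complex x ` Y x)"
  proof
    fix z assume z: "z \<in> {z. eval2 P (Re z) (Im z) = 0 \<and> eval2 G (Re z) (Im z) = 0}"
    have "poly d (Re z) = eval2 [:d:] (Re z) (Im z)" by simp
    also have "\<dots> = 0" unfolding d using z by simp
    finally show "z \<in> (\<Union>x\<in>{x. poly d x = 0}. Complex x ` Y x)"
      using z by (auto simp: Y_def intro!: image_eqI[of _ _ "Im z"])
  qed
  ultimately show ?thesis by (rule finite_subset[rotated])
qed

text \<open>On the real plane \<open>B(z, cnj z)\<close> splits into two real polynomials, so divisibility by the
  irreducible \<open>P\<close> carries its vanishing over to the whole complexified curve.\<close>
lemma vanishing_on_complexified_curve:
  fixes B :: "complex poly poly"
  assumes "irreducible P" "infinite A" "A \<subseteq> zero_set2 P"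
    and vanish: "\<And>z. z \<in> A \<Longrightarrow> eval2 B z (cnj z) = 0"
    and zw: "schwarz_poly P z w = 0"
  shows "eval2 B z w = 0"
proof -
  \<comment> \<open>\<open>M\<close> is \<open>B\<close> in the coordinates \<open>x\<close>,
    \<open>y\<close> with \<open>z = x + \<i> * y\<close> and \<open>w = x - \<i> * y\<close>, so
    real arguments correspond to \<open>w = cnj z\<close>.\<close>
  obtain M where "\<forall>x y. eval2 M x y = eval2 B (eval2 [:[:0,1:],[:\<i>:]:] x y) (eval2 [:[:0,1:],[:-\<i>:]:] x y)"
    using eval2_compose_ex by blast
  hence M: "eval2 M x y = eval2 B (x + \<i> * y) (x - \<i> * y)" for x y
    by (simp add: mult.commute)
  obtain G1 G2 where G: "M = complexify G1 + [:[:\<i>:]:] * complexify G2"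
    by (rule real_imaginary_decomposition)
  have "eval2 G1 (Re z) (Im z) = 0 \<and> eval2 G2 (Re z) (Im z) = 0" if "z \<in> A" for z
  proof -
    have "eval2 M (of_real (Re z)) (of_real (Im z)) = eval2 B z (cnj z)"
      unfolding M by (metis complex_cnj complex_eq complex_cnj_add complex_cnj_complex_of_real complex_cnj_i complex_cnj_mult diff_conv_add_uminus mult_minus_left)
    also have "\<dots> = 0" using vanish that by simp
    finally have "of_real (eval2 G1 (Re z) (Im z)) + \<i> * of_real (eval2 G2 (Re z) (Im z)) = 0"
      unfolding G by simp
    thus ?thesis by (simp add: complex_eq_iff)
  qed
  hence "A \<subseteq> {z. eval2 P (Re z) (Im z) = 0 \<and> eval2 G1 (Re z) (Im z) = 0}"
        "A \<subseteq> {z. eval2 P (Re z) (Im z) = 0 \<and> eval2 G2 (Re z) (Im z) = 0}"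
    using assms(3) by (auto simp: zero_set2_def)
  hence "P dvd G1" "P dvd G2"
    using finite_common_zeros[OF assms(1)] assms(2) finite_subset by blast+
  then obtain R1 R2 where "G1 = P * R1" "G2 = P * R2"
    by (auto elim!: dvdE)
  hence "M = complexify P * (complexify R1 + [:[:\<i>:]:] * complexify R2)"
    using G by (simp add: complexify_mult algebra_simps)
  hence "eval2 M ((z + w) / 2) ((z - w) / (2 * \<i>)) = 0"
    using zw by (simp add: schwarz_poly_def)
  moreover have "(z + w) / 2 + \<i> * ((z - w) / (2 * \<i>)) = z" "(z + w) / 2 - \<i> * ((z - w) / (2 * \<i>)) = w"
    by (simp_all add: field_simps)
  ultimately show ?thesis
    unfolding M by simp
qed

section \<open>Branches of a separable polynomial\<close>

lemma tendsto_eval2 [tendsto_intros]: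
  fixes R :: "'a::{real_normed_field} poly poly"
  assumes "(f \<longlongrightarrow> a) F" "(g \<longlongrightarrow> b) F"
  shows "((\<lambda>x. eval2 R (f x) (g x)) \<longlongrightarrow> eval2 R a b) F"
  by (induction R) (auto intro!: tendsto_intros assms)

locale separable_curve =
  fixes R U V :: "complex poly poly" and d :: "complex poly"
  assumes R_nonzero: "R \<noteq> 0" and bezout: "[:d:] = U * R + V * pderiv R" and d_nonzero: "d \<noteq> 0"
begin

definition lc where "lc = lead_coeff R"

text \<open>Off \<open>D\<close> every fibre has full degree, and its roots are simple because
  \<open>d\<close> serves as a discriminant through the Bezout identity.\<close>

definition D where "D = {z. poly d z = 0} \<union> {z. poly lc z = 0}"

definition W where "W z = {w. eval2 R z w = 0}"

lemma finite_D: "finite D"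
  unfolding D_def lc_def using R_nonzero d_nonzero by (auto intro: poly_roots_finite)

lemma lc_nonzero: "z \<notin> D \<Longrightarrow> poly lc z \<noteq> 0"
  by (auto simp: D_def)

lemma degree_slice: "z \<notin> D \<Longrightarrow> degree (slice R z) = degree R"
  using lc_nonzero[of z]
  by (intro antisym degree_le le_degree) (auto simp: lc_def coeff_eq_0)

lemma slice_nonzero: "z \<notin> D \<Longrightarrow> slice R z \<noteq> 0"
  using lc_nonzero[of z] unfolding lc_def by (metis coeff_0 coeff_slice)

lemma pderiv_root_nonzero:
  assumes "z \<notin> D" "w \<in> W z"
  shows "eval2 (pderiv R) z w \<noteq> 0"
proof
  assume "eval2 (pderiv R) z w = 0"
  hence "eval2 [:d:] z w = 0"
    unfolding bezout using assms by (simp add: W_def)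
  thus False using assms by (simp add: D_def)
qed

lemma slice_factorization:
  assumes "z \<notin> D"
  shows "slice R z = smult (poly lc z) (\<Prod>w\<in>W z. [:-w, 1:])"
proof -
  have "rsquarefree (slice R z)"
    unfolding rsquarefree_roots
    using pderiv_root_nonzero[OF assms] by (simp add: pderiv_slice W_def)
  thus ?thesis
    using complex_poly_decompose_rsquarefree[of "slice R z"] degree_slice[OF assms]
    by (simp add: W_def lc_def)
qed

lemma finite_W: "z \<notin> D \<Longrightarrow> finite (W z)"
  using poly_roots_finite[OF slice_nonzero, of z] by (simp add: W_def)

lemma card_W:
  assumes "z \<notin> D"
  shows "card (W z) = degree R"
proof -
  have "degree (slice R z) = card (W z)"
    by (subst slice_factorization[OF assms])
       (use lc_nonzero[OF assms] in \<open>simp add: degree_prod_eq_sum_degree\<close>)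
  thus ?thesis using degree_slice[OF assms] by simp
qed

lemma eval2_factorization:
  assumes "z \<notin> D"
  shows "eval2 R z w = poly lc z * (\<Prod>w'\<in>W z. w - w')"
proof -
  have "eval2 R z w = poly (slice R z) w" by simp
  thus ?thesis
    unfolding slice_factorization[OF assms] by (simp add: poly_prod)
qed

lemma eventually_not_in_D: "z \<notin> D \<Longrightarrow> eventually (\<lambda>z. z \<notin> D) (nhds z)"
  using eventually_nhds_in_open[of "-D" z] finite_imp_closed[OF finite_D] by auto

text \<open>The value of \<open>R\<close> at \<open>(z, w0)\<close> is \<open>lc\<close> times the
  product of the \<open>w0 - w\<close> over the roots \<open>w\<close>. It tends to 0 as
  \<open>z\<close> tends to \<open>z0\<close>, so the roots cannot all stay at distance
  \<open>\<epsilon>\<close> from \<open>w0\<close>.\<close>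

lemma nearby_root:
  assumes z0: "z0 \<notin> D" "w0 \<in> W z0" and "\<epsilon> > 0"
  shows "eventually (\<lambda>z. \<exists>w\<in>W z. dist w w0 < \<epsilon>) (nhds z0)"
proof -
  have "((\<lambda>z. norm (eval2 R z w0)) \<longlongrightarrow> norm (eval2 R z0 w0)) (nhds z0)"
    by (intro tendsto_intros filterlim_ident)
  moreover have "((\<lambda>z. norm (poly lc z) * \<epsilon> ^ degree R) \<longlongrightarrow> norm (poly lc z0) * \<epsilon> ^ degree R) (nhds z0)"
    by (intro tendsto_intros filterlim_ident)
  moreover have "norm (eval2 R z0 w0) < norm (poly lc z0) * \<epsilon> ^ degree R"
    using z0 lc_nonzero[of z0] \<open>\<epsilon> > 0\<close> by (simp add: W_def)
  ultimately have "eventually (\<lambda>z. 0 < norm (poly lc z) * \<epsilon> ^ degree R - norm (eval2 R z w0)) (nhds z0)"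
    by (intro order_tendstoD(1)[OF tendsto_diff]) auto
  hence "eventually (\<lambda>z. norm (eval2 R z w0) < norm (poly lc z) * \<epsilon> ^ degree R) (nhds z0)"
    by simp
  thus ?thesis
    using eventually_not_in_D[OF z0(1)]
  proof eventually_elim
    case (elim z)
    show ?case
    proof (rule ccontr)
      assume "\<not> (\<exists>w\<in>W z. dist w w0 < \<epsilon>)"
      hence "\<epsilon> \<le> norm (w0 - w)" if "w \<in> W z" for w
        using that by (metis dist_norm dist_commute not_le)
      hence "(\<Prod>w\<in>W z. \<epsilon>) \<le> (\<Prod>w\<in>W z. norm (w0 - w))"
        using \<open>\<epsilon> > 0\<close> by (intro prod_mono) auto
      hence "\<epsilon> ^ degree R \<le> norm (\<Prod>w\<in>W z. w0 - w)"
        using card_W[of z] elim by (simp add: prod_norm)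
      hence "norm (poly lc z) * \<epsilon> ^ degree R \<le> norm (eval2 R z w0)"
        using elim by (simp add: eval2_factorization norm_mult mult_left_mono)
      thus False using elim by simp
    qed
  qed
qed

text \<open>Dividing \<open>R\<close> by \<open>w - w1\<close> gives a quotient \<open>E\<close> and
  a remainder \<open>(z - z1) * s(z)\<close>. Along the section this turns the difference quotient
  into \<open>- s / E\<close>, whose limit exists because \<open>E\<close> at
  \<open>(z1, w1)\<close> is the nonzero derivative of \<open>R\<close> in \<open>w\<close>.\<close>

lemma section_differentiable:
  assumes z1: "z1 \<notin> D" and tends: "(\<omega> \<longlongrightarrow> \<omega> z1) (nhds z1)"
    and root: "eventually (\<lambda>z. \<omega> z \<in> W z) (nhds z1)"
  shows "\<omega> field_differentiable (at z1)"
proof -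
  define w1 where "w1 = \<omega> z1"
  have w1: "w1 \<in> W z1"
    using root w1_def eventually_nhds_x_imp_x by fastforce
  define E where "E = synthetic_div R [:w1:]"
  have RE: "R = [:-[:w1:], 1:] * E + [:poly R [:w1:]:]"
    unfolding E_def by (rule synthetic_div_correct'[symmetric])
  have ev: "eval2 R z w = (w - w1) * eval2 E z w + poly (poly R [:w1:]) z" for z w
    by (subst RE) (simp add: algebra_simps)
  have "pderiv R = E + [:-[:w1:], 1:] * pderiv E"
    by (subst RE) (simp add: pderiv_add pderiv_mult pderiv_pCons del: mult_pCons_left)
  hence "eval2 (pderiv R) z1 w1 = eval2 E z1 w1"
    by simp
  hence E1: "eval2 E z1 w1 \<noteq> 0"
    using pderiv_root_nonzero[OF z1 w1] by simp
  have "poly (poly R [:w1:]) z1 = 0"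
    using w1 ev[of z1 w1] by (simp add: W_def)
  then obtain s where s: "poly R [:w1:] = [:-z1, 1:] * s"
    by (auto simp: poly_eq_0_iff_dvd elim: dvdE)
  have tE: "((\<lambda>z. eval2 E z (\<omega> z)) \<longlongrightarrow> eval2 E z1 w1) (nhds z1)"
    unfolding w1_def by (intro tendsto_intros filterlim_ident tends)
  have "eventually (\<lambda>z. eval2 E z (\<omega> z) \<noteq> 0) (nhds z1)"
    using tendsto_imp_eventually_ne[OF tE E1] .
  hence ev: "eventually (\<lambda>z. - poly s z / eval2 E z (\<omega> z) = (\<omega> z - \<omega> z1) / (z - z1)) (at z1)"
    unfolding eventually_at_filter using root
  proof eventually_elim
    case (elim z)
    show ?case
    proof (intro impI)
      assume "z \<noteq> z1"
      have "(\<omega> z - w1) * eval2 E z (\<omega> z) + (z - z1) * poly s z = 0"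
        using elim(2) ev[of z "\<omega> z"] by (simp add: W_def s algebra_simps)
      hence "(\<omega> z - w1) * eval2 E z (\<omega> z) = - (z - z1) * poly s z"
        by (simp add: eq_neg_iff_add_eq_0 algebra_simps)
      thus "- poly s z / eval2 E z (\<omega> z) = (\<omega> z - \<omega> z1) / (z - z1)"
        using elim(1) \<open>z \<noteq> z1\<close> by (simp add: w1_def field_simps)
    qed
  qed
  have "((\<lambda>z. - poly s z / eval2 E z (\<omega> z)) \<longlongrightarrow> - poly s z1 / eval2 E z1 w1) (at z1)"
    by (intro tendsto_divide tendsto_minus tendsto_mono[OF at_within_le_nhds tE] E1)
       (auto intro!: tendsto_intros)
  hence "((\<lambda>z. (\<omega> z - \<omega> z1) / (z - z1)) \<longlongrightarrow> - poly s z1 / eval2 E z1 w1) (at z1)"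
    using ev by (rule Lim_transform_eventually)
  thus ?thesis
    unfolding field_differentiable_def has_field_derivative_iff by blast
qed

text \<open>The balls of radius \<open>\<epsilon>\<close> around the roots over \<open>z0\<close>
  are disjoint, and each contains a root over every nearby \<open>z\<close>. All fibres have
  \<open>degree R\<close> points, so each ball contains exactly one.\<close>

lemma local_sections:
  assumes z0: "z0 \<notin> D"
  obtains r \<epsilon> \<omega> where "r > 0" "\<epsilon> > 0" "ball z0 r \<inter> D = {}"
    "\<And>w. w \<in> W z0 \<Longrightarrow> \<omega> w holomorphic_on ball z0 r" "\<And>w. w \<in> W z0 \<Longrightarrow> \<omega> w z0 = w"
    "\<And>w z. w \<in> W z0 \<Longrightarrow> z \<in> ball z0 r \<Longrightarrow> W z \<inter> ball w \<epsilon> = {\<omega> w z}"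
    "\<And>z. z \<in> ball z0 r \<Longrightarrow> bij_betw (\<lambda>w. \<omega> w z) (W z0) (W z)"
proof -
  \<comment> \<open>The extra element 1 keeps the minimum defined when the fibre has fewer than two
    points.\<close>
  define S where "S = insert 1 ((\<lambda>(w, w'). dist w w') ` {(w, w') \<in> W z0 \<times> W z0. w \<noteq> w'})"
  have S: "finite S" "S \<noteq> {}"
    unfolding S_def using finite_W[OF z0] by (auto intro: finite_subset[of _ "W z0 \<times> W z0"])
  obtain \<delta> where \<delta>: "\<delta> > 0" "\<And>w w'. w \<in> W z0 \<Longrightarrow> w' \<in> W z0 \<Longrightarrow> w \<noteq> w' \<Longrightarrow> \<delta> \<le> dist w w'"
  proof
    show "Min S > 0" using S by (subst Min_gr_iff) (auto simp: S_def)
    show "Min S \<le> dist w w'" if "w \<in> W z0" "w' \<in> W z0" "w \<noteq> w'" for w w'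
      using S that by (intro Min_le) (force simp: S_def)+
  qed
  define \<epsilon> where "\<epsilon> = \<delta> / 2"
  have "\<epsilon> > 0" using \<delta> by (simp add: \<epsilon>_def)
  have disj: "w = w'" if "w \<in> W z0" "w' \<in> W z0" "dist v w < \<epsilon>" "dist v w' < \<epsilon>" for v w w'
    using \<delta>(2)[OF that(1,2)] dist_triangle_half_r[of v w \<delta> w'] that(3,4) by (force simp: \<epsilon>_def)
  have "eventually (\<lambda>z. z \<notin> D \<and> (\<forall>w\<in>W z0. \<exists>w'\<in>W z. dist w' w < \<epsilon>)) (nhds z0)"
    using eventually_not_in_D[OF z0] finite_W[OF z0] nearby_root[OF z0 _ \<open>\<epsilon> > 0\<close>]
    by (simp add: eventually_conj_iff eventually_ball_finite)
  then obtain r where r: "r > 0" "\<And>z. dist z z0 < r \<Longrightarrow> z \<notin> D \<and> (\<forall>w\<in>W z0. \<exists>w'\<in>W z. dist w' w < \<epsilon>)"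
    unfolding eventually_nhds_metric by blast
  hence rD: "\<And>z. z \<in> ball z0 r \<Longrightarrow> z \<notin> D"
    and ex: "\<And>z w. z \<in> ball z0 r \<Longrightarrow> w \<in> W z0 \<Longrightarrow> \<exists>w'. w' \<in> W z \<and> dist w' w < \<epsilon>"
    by (auto simp: dist_commute)
  define \<omega> where "\<omega> w z = (SOME w'. w' \<in> W z \<and> dist w' w < \<epsilon>)" for w z
  have \<omega>: "\<omega> w z \<in> W z \<and> dist (\<omega> w z) w < \<epsilon>" if "z \<in> ball z0 r" "w \<in> W z0" for z w
    using someI_ex[OF ex[OF that]] by (simp add: \<omega>_def)
  have bij: "bij_betw (\<lambda>w. \<omega> w z) (W z0) (W z)" if z: "z \<in> ball z0 r" for z
  proof -
    have inj: "inj_on (\<lambda>w. \<omega> w z) (W z0)"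
      by (rule inj_onI) (use \<omega>[OF z] in \<open>metis disj\<close>)
    moreover have "(\<lambda>w. \<omega> w z) ` W z0 = W z"
      using \<omega>[OF z] finite_W card_W rD z0 z card_image[OF inj]
      by (intro card_subset_eq) auto
    ultimately show ?thesis by (simp add: bij_betw_def)
  qed
  have uniq: "W z \<inter> ball w \<epsilon> = {\<omega> w z}" if w: "w \<in> W z0" and z: "z \<in> ball z0 r" for w z
  proof -
    have "W z \<inter> ball w \<epsilon> \<subseteq> {\<omega> w z}"
    proof
      fix v assume "v \<in> W z \<inter> ball w \<epsilon>"
      hence v: "v \<in> W z" "dist w v < \<epsilon>" by auto
      obtain w' where w': "w' \<in> W z0" "v = \<omega> w' z"
        using bij[OF z] v by (auto simp: bij_betw_def)
      have "w = w'"
        using disj[OF w w'(1), of v] \<omega>[OF z w'(1)] v w' by (simp add: dist_commute)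
      thus "v \<in> {\<omega> w z}" using w' by simp
    qed
    moreover have "\<omega> w z \<in> W z \<inter> ball w \<epsilon>"
      using \<omega>[OF z w] by (simp add: dist_commute)
    ultimately show ?thesis by blast
  qed
  have "\<omega> w holomorphic_on ball z0 r" if w: "w \<in> W z0" for w
    unfolding holomorphic_on_def
  proof
    fix z1 assume z1: "z1 \<in> ball z0 r"
    have ball: "eventually (\<lambda>z. z \<in> ball z0 r) (nhds z1)"
      using z1 by (intro eventually_nhds_in_open) auto
    have "(\<omega> w \<longlongrightarrow> \<omega> w z1) (nhds z1)"
    proof (rule tendstoI)
      fix e :: real assume "e > 0"
      \<comment> \<open>A root this close to \<open>\<omega> w z1\<close> still lies in the ball
        around \<open>w\<close>, where the section is the only root.\<close>
      define e' where "e' = min e (\<epsilon> - dist (\<omega> w z1) w)"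
      have "e' > 0" using \<open>e > 0\<close> \<omega>[OF z1 w] by (simp add: e'_def)
      have "eventually (\<lambda>z. \<exists>v\<in>W z. dist v (\<omega> w z1) < e') (nhds z1)"
        using nearby_root[OF rD[OF z1] _ \<open>e' > 0\<close>] \<omega>[OF z1 w] by simp
      thus "eventually (\<lambda>z. dist (\<omega> w z) (\<omega> w z1) < e) (nhds z1)"
        using ball
      proof eventually_elim
        case (elim z)
        then obtain v where v: "v \<in> W z" "dist v (\<omega> w z1) < e'" by blast
        have "dist v w < \<epsilon>"
          using v dist_triangle[of v w "\<omega> w z1"] by (simp add: e'_def)
        hence "v \<in> W z \<inter> ball w \<epsilon>"
          using v by (simp add: dist_commute)
        hence "v = \<omega> w z"
          using uniq[OF w elim(2)] by blast
        thus ?case using v by (simp add: e'_def)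
      qed
    qed
    moreover have "eventually (\<lambda>z. \<omega> w z \<in> W z) (nhds z1)"
      using ball by eventually_elim (use \<omega> w in blast)
    ultimately have "\<omega> w field_differentiable (at z1)"
      using section_differentiable rD z1 by blast
    thus "\<omega> w field_differentiable (at z1 within ball z0 r)"
      using field_differentiable_at_within by blast
  qed
  moreover have "\<omega> w z0 = w" if "w \<in> W z0" for w
  proof -
    have "w \<in> W z0 \<inter> ball w \<epsilon>" using that \<open>\<epsilon> > 0\<close> by simp
    thus ?thesis using uniq[OF that, of z0] r(1) by simp
  qed
  ultimately show ?thesis
    using that[of r \<epsilon> \<omega>] r(1) \<open>\<epsilon> > 0\<close> rD uniq bij by blast
qed

end

section \<open>Polynomial growth\<close>

text \<open>Riemann's theorem on removable singularities, applied to one point at a time. The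
  extension agrees with \<open>f\<close> near the remaining points, so their bounds persist.\<close>

lemma holomorphic_extension_finite:
  assumes "finite D"
  shows "f holomorphic_on -D \<Longrightarrow> (\<And>a. a \<in> D \<Longrightarrow> \<exists>B. eventually (\<lambda>z. norm (f z) \<le> B) (at a))
    \<Longrightarrow> \<exists>g. g holomorphic_on UNIV \<and> (\<forall>z. z \<notin> D \<longrightarrow> g z = f z)"
  using assms
proof (induction D arbitrary: f rule: finite_induct)
  case empty
  thus ?case by auto
next
  case (insert a D)
  have op: "open (-D)"
    using insert.hyps by (simp add: finite_imp_closed open_Compl)
  have hol: "f holomorphic_on (-D) - {a}"
    by (rule holomorphic_on_subset[OF insert.prems(1)]) auto
  have int: "a \<in> interior (-D)"
    using op insert.hyps by (simp add: interior_open)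
  obtain f' where f': "f' holomorphic_on -D" "\<forall>z\<in>-D-{a}. f' z = f z"
    using iffD2[OF holomorphic_on_extend_bounded[OF hol int] insert.prems(2)[OF insertI1]] by blast
  have "\<exists>B. eventually (\<lambda>z. norm (f' z) \<le> B) (at b)" if b: "b \<in> D" for b
  proof -
    obtain B where B: "eventually (\<lambda>z. norm (f z) \<le> B) (at b)"
      using insert.prems(2) b by blast
    have "eventually (\<lambda>z. z \<in> -((insert a D) - {b})) (nhds b)"
      using insert.hyps by (intro eventually_nhds_in_open open_Compl finite_imp_closed) auto
    hence "eventually (\<lambda>z. z \<notin> insert a D) (at b)"
      unfolding eventually_at_filter by eventually_elim auto
    with B have "eventually (\<lambda>z. norm (f' z) \<le> B) (at b)"
      by eventually_elim (use f' in auto)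
    thus ?thesis by blast
  qed
  from insert.IH[OF f'(1) this] obtain g where "g holomorphic_on UNIV" "\<forall>z. z \<notin> D \<longrightarrow> g z = f' z"
    by blast
  thus ?case using f'(2) by auto
qed

definition poly_growth :: "(complex \<Rightarrow> real) \<Rightarrow> bool" where
  "poly_growth f \<longleftrightarrow> (\<exists>C m. \<forall>z. f z \<le> C * (1 + norm z) ^ m)"

lemma poly_growthE:
  assumes "poly_growth f"
  obtains C m where "C \<ge> 0" "\<And>z. f z \<le> C * (1 + norm z) ^ m"
proof -
  obtain C m where Cm: "\<And>z. f z \<le> C * (1 + norm z) ^ m"
    using assms unfolding poly_growth_def by blast
  have "f z \<le> max C 0 * (1 + norm z) ^ m" for z
    by (rule order.trans[OF Cm]) (intro mult_right_mono, auto)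
  thus ?thesis using that[of "max C 0" m] by simp
qed

lemma poly_growth_add:
  assumes "poly_growth f" "poly_growth g"
  shows "poly_growth (\<lambda>z. f z + g z)"
proof -
  obtain C m where f: "C \<ge> 0" "\<And>z. f z \<le> C * (1 + norm z) ^ m"
    using assms(1) by (rule poly_growthE) blast
  obtain C' m' where g: "C' \<ge> 0" "\<And>z. g z \<le> C' * (1 + norm z) ^ m'"
    using assms(2) by (rule poly_growthE) blast
  have "f z + g z \<le> (C + C') * (1 + norm z) ^ (m + m')" for z
  proof -
    have "C * (1 + norm z) ^ m \<le> C * (1 + norm z) ^ (m + m')"
      "C' * (1 + norm z) ^ m' \<le> C' * (1 + norm z) ^ (m + m')"
      using f(1) g(1) by (intro mult_left_mono power_increasing; simp)+
    thus ?thesis using f(2)[of z] g(2)[of z] by (simp add: distrib_right)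
  qed
  thus ?thesis unfolding poly_growth_def by blast
qed

lemma poly_growth_mult:
  assumes "poly_growth f" "poly_growth g" "\<And>z. f z \<ge> 0" "\<And>z. g z \<ge> 0"
  shows "poly_growth (\<lambda>z. f z * g z)"
proof -
  obtain C m where f: "C \<ge> 0" "\<And>z. f z \<le> C * (1 + norm z) ^ m"
    using assms(1) by (rule poly_growthE) blast
  obtain C' m' where g: "C' \<ge> 0" "\<And>z. g z \<le> C' * (1 + norm z) ^ m'"
    using assms(2) by (rule poly_growthE) blast
  have "f z * g z \<le> (C * C') * (1 + norm z) ^ (m + m')" for z
    using mult_mono[OF f(2)[of z] g(2)[of z]] f(1) assms(4)[of z]
    by (simp add: power_add mult_ac)
  thus ?thesis unfolding poly_growth_def by blast
qed

lemma poly_growth_const: "poly_growth (\<lambda>_. c)"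
  unfolding poly_growth_def by (rule exI[of _ c], rule exI[of _ 0]) simp

lemma poly_growth_poly: "poly_growth (\<lambda>z. norm (poly p z))"
proof (induction p)
  case 0
  thus ?case using poly_growth_const[of 0] by simp
next
  case (pCons a p)
  have "poly_growth norm"
    unfolding poly_growth_def by (rule exI[of _ 1], rule exI[of _ 1]) simp
  hence "poly_growth (\<lambda>z. norm a + norm z * norm (poly p z))"
    by (intro poly_growth_add poly_growth_const poly_growth_mult pCons) auto
  then obtain C m where "C \<ge> 0" and *: "\<And>z. norm a + norm z * norm (poly p z) \<le> C * (1 + norm z) ^ m"
    by (rule poly_growthE) blast
  have "norm (poly (pCons a p) z) \<le> C * (1 + norm z) ^ m" for z
    using norm_triangle_ineq[of a "z * poly p z"] *[of z] by (simp add: norm_mult)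
  thus ?case unfolding poly_growth_def by blast
qed

lemma poly_growth_sum:
  assumes "\<And>i. i \<in> I \<Longrightarrow> poly_growth (f i)"
  shows "poly_growth (\<lambda>z. \<Sum>i\<in>I. f i z)"
  using assms
proof (induction I rule: infinite_finite_induct)
  case (insert x F)
  thus ?case by (simp add: poly_growth_add)
qed (simp_all add: poly_growth_const)

lemma poly_growth_power:
  assumes "poly_growth f" "\<And>z. f z \<ge> 0"
  shows "poly_growth (\<lambda>z. f z ^ n)"
  by (induction n) (auto intro!: poly_growth_const poly_growth_mult assms zero_le_power)

text \<open>The majorant is locally bounded, so the points of \<open>D\<close> are removable. The
  entire extension grows polynomially and Liouville's theorem makes it a polynomial.\<close>

lemma poly_growth_imp_polynomial:
  assumes D: "finite D" and hol: "f holomorphic_on -D"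
    and growth: "poly_growth M" "\<And>z. z \<notin> D \<Longrightarrow> norm (f z) \<le> M z"
  obtains p where "\<And>z. z \<notin> D \<Longrightarrow> f z = poly p z"
proof -
  obtain C m where C: "C \<ge> 0" "\<And>z. M z \<le> C * (1 + norm z) ^ m"
    using growth(1) by (rule poly_growthE) blast
  have ev: "eventually (\<lambda>z. z \<notin> D) (at a)" for a
    using islimpt_finite[OF D, of a] by (simp add: islimpt_iff_eventually)
  have "\<exists>B. eventually (\<lambda>z. norm (f z) \<le> B) (at a)" for a
  proof -
    have "((\<lambda>z. C * (1 + norm z) ^ m) \<longlongrightarrow> C * (1 + norm a) ^ m) (at a)"
      by (intro tendsto_intros)
    hence "eventually (\<lambda>z. C * (1 + norm z) ^ m < C * (1 + norm a) ^ m + 1) (at a)"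
      by (rule order_tendstoD(2)) simp
    with ev[of a] have "eventually (\<lambda>z. norm (f z) \<le> C * (1 + norm a) ^ m + 1) (at a)"
    proof eventually_elim
      case (elim z)
      thus ?case using growth(2)[of z] C(2)[of z] by linarith
    qed
    thus ?thesis by blast
  qed
  then obtain g where g: "g holomorphic_on UNIV" "\<And>z. z \<notin> D \<Longrightarrow> g z = f z"
    using holomorphic_extension_finite[OF D hol] by blast
  obtain B where B: "\<And>z. z \<in> D \<Longrightarrow> norm z \<le> B"
    using finite_imp_bounded[OF D] by (auto simp: bounded_iff)
  \<comment> \<open>Beyond this radius \<open>z\<close> lies outside \<open>D\<close> and
    \<open>1 + norm z \<le> 2 * norm z\<close>.\<close>
  have "norm (g z) \<le> (C * 2 ^ m) * norm z ^ m" if z: "max 1 (B + 1) \<le> norm z" for z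
  proof -
    have "z \<notin> D" using B[of z] z by auto
    hence "norm (g z) \<le> C * (1 + norm z) ^ m"
      using g(2)[of z] growth(2)[of z] C(2)[of z] by simp
    also have "\<dots> \<le> C * (2 * norm z) ^ m"
      using z C(1) by (intro mult_left_mono power_mono) auto
    finally show ?thesis by (simp add: power_mult_distrib mult_ac)
  qed
  hence "g z = (\<Sum>k\<le>m. (deriv ^^ k) g 0 / fact k * z ^ k)" for z
    by (rule Liouville_polynomial[OF g(1)])
  also have "(\<Sum>k\<le>m. (deriv ^^ k) g 0 / fact k * z ^ k) = poly (\<Sum>k\<le>m. monom ((deriv ^^ k) g 0 / fact k) k) z" for z
    by (simp add: poly_sum poly_monom)
  finally have gp: "g z = poly (\<Sum>k\<le>m. monom ((deriv ^^ k) g 0 / fact k) k) z" for z .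
  show ?thesis by (rule that) (rule trans[OF g(2)[symmetric] gp])
qed

text \<open>Up to sign these coefficients are the elementary symmetric functions of the
  \<open>f i z\<close>.\<close>

lemma holomorphic_on_coeff_prod_roots:
  assumes "finite I" "\<And>i. i \<in> I \<Longrightarrow> f i holomorphic_on S"
  shows "(\<lambda>z. coeff (\<Prod>i\<in>I. [:- f i z, 1:]) j) holomorphic_on S"
  using assms
proof (induction I arbitrary: j rule: finite_induct)
  case empty
  thus ?case by simp
next
  case (insert x F)
  have "(\<lambda>z. - f x z * coeff (\<Prod>i\<in>F. [:- f i z, 1:]) j +
      (case j of 0 \<Rightarrow> 0 | Suc k \<Rightarrow> coeff (\<Prod>i\<in>F. [:- f i z, 1:]) k)) holomorphic_on S"
    using insert by (cases j) (auto intro!: holomorphic_intros)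
  thus ?case using insert.hyps
    by (cases j) (simp_all add: coeff_pCons)
qed

text \<open>Expanding the right side gives the sum of all elementary symmetric functions of the
  absolute values of the roots.\<close>

lemma norm_coeff_prod_roots_le:
  fixes I :: "complex set"
  assumes "finite I"
  shows "norm (coeff (\<Prod>w\<in>I. [:- w, 1:]) j) \<le> (\<Prod>w\<in>I. 1 + norm w)"
  using assms
proof (induction I arbitrary: j rule: finite_induct)
  case empty
  thus ?case by (cases j) simp_all
next
  case (insert x F)
  define p where "p = (\<Prod>w\<in>F. [:- w, 1:])"
  define c where "c = (case j of 0 \<Rightarrow> 0 | Suc k \<Rightarrow> coeff p k)"
  have pr: "0 \<le> (\<Prod>w\<in>F. 1 + norm w)" by (intro prod_nonneg) (simp add: add_nonneg_nonneg)
  have c: "norm c \<le> (\<Prod>w\<in>F. 1 + norm w)"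
    using insert.IH pr by (cases j) (auto simp: c_def p_def)
  have "norm (coeff ([:- x, 1:] * p) j) = norm (- x * coeff p j + c)"
    by (cases j) (simp_all add: c_def coeff_pCons)
  also have "\<dots> \<le> norm x * norm (coeff p j) + norm c"
    by (rule order.trans[OF norm_triangle_ineq]) (simp add: norm_mult)
  also have "\<dots> \<le> norm x * (\<Prod>w\<in>F. 1 + norm w) + (\<Prod>w\<in>F. 1 + norm w)"
    using c insert.IH[of j] by (intro add_mono mult_left_mono) (auto simp: p_def)
  finally show ?case using insert.hyps by (simp add: p_def algebra_simps)
qed

section \<open>Branches on which an analytic function vanishes\<close>

text \<open>Analyticity of \<open>h\<close> in two variables enters only through its restrictions to
  graphs of holomorphic functions.\<close>

locale vanishing_branches = separable_curve +
  fixes h :: "complex \<Rightarrow> complex \<Rightarrow> complex"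
  assumes h_holomorphic: "\<And>S \<omega>. open S \<Longrightarrow> \<omega> holomorphic_on S \<Longrightarrow> (\<lambda>z. h z (\<omega> z)) holomorphic_on S"
begin

text \<open>The points over \<open>z\<close> at which \<open>h\<close> vanishes on a whole piece of the curve. Local constancy of this
  set of branches replaces monodromy.\<close>
definition K where
  "K z = {w \<in> W z. \<exists>\<epsilon>>0. \<forall>z' w'. dist z' z < \<epsilon> \<longrightarrow> dist w' w < \<epsilon> \<longrightarrow> w' \<in> W z' \<longrightarrow> h z' w' = 0}"

lemma K_vanishes: "w \<in> K z \<Longrightarrow> h z w = 0"
  unfolding K_def by force

lemma K_subset_W: "K z \<subseteq> W z"
  by (auto simp: K_def)

text \<open>One direction is the identity theorem along the section. For the other, the graph of the
  section is the whole curve near each of its points.\<close>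

lemma section_in_K_iff:
  assumes hol: "\<omega> holomorphic_on ball z0 r"
    and W: "\<And>z. z \<in> ball z0 r \<Longrightarrow> W z \<inter> ball w0 \<epsilon> = {\<omega> z}"
    and z: "z \<in> ball z0 r"
  shows "\<omega> z \<in> K z \<longleftrightarrow> (\<forall>z'\<in>ball z0 r. h z' (\<omega> z') = 0)"
proof
  assume "\<omega> z \<in> K z"
  then obtain e where e: "e > 0" "\<And>z' w'. dist z' z < e \<Longrightarrow> dist w' (\<omega> z) < e \<Longrightarrow> w' \<in> W z' \<Longrightarrow> h z' w' = 0"
    unfolding K_def by blast
  have ball: "eventually (\<lambda>z. z \<in> ball z0 r) (nhds z)"
    using z by (intro eventually_nhds_in_open) auto
  have "continuous_on (ball z0 r) \<omega>"
    using hol holomorphic_on_imp_continuous_on by blast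
  hence "isCont \<omega> z"
    using z by (simp add: continuous_on_eq_continuous_at)
  hence "(\<omega> \<longlongrightarrow> \<omega> z) (nhds z)"
    unfolding isCont_def tendsto_at_iff_tendsto_nhds .
  hence "eventually (\<lambda>z'. dist (\<omega> z') (\<omega> z) < e) (nhds z)"
    using e(1) by (rule tendstoD)
  moreover have "eventually (\<lambda>z'. dist z' z < e) (nhds z)"
    using e(1) unfolding eventually_nhds_metric by blast
  ultimately have "eventually (\<lambda>z'. z' \<in> ball z0 r \<and> h z' (\<omega> z') = 0) (nhds z)"
    using ball
  proof eventually_elim
    case (elim z')
    have "\<omega> z' \<in> W z'" using W[OF elim(3)] by blast
    thus ?case using e(2) elim by blast
  qed
  then obtain S where S: "open S" "z \<in> S" "\<And>z'. z' \<in> S \<Longrightarrow> z' \<in> ball z0 r \<and> h z' (\<omega> z') = 0"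
    unfolding eventually_nhds by blast
  have "z islimpt S"
    using S by (simp add: interior_limit_point interior_open)
  have "(\<lambda>z. h z (\<omega> z)) holomorphic_on ball z0 r"
    using hol by (intro h_holomorphic) auto
  thus "\<forall>z'\<in>ball z0 r. h z' (\<omega> z') = 0"
    using analytic_continuation[of "\<lambda>z. h z (\<omega> z)" "ball z0 r" S z] S z \<open>z islimpt S\<close> by blast
next
  assume v: "\<forall>z'\<in>ball z0 r. h z' (\<omega> z') = 0"
  have "\<omega> z \<in> W z \<inter> ball w0 \<epsilon>" using W[OF z] by blast
  hence wz: "\<omega> z \<in> W z" "\<omega> z \<in> ball w0 \<epsilon>" by auto
  obtain e1 where e1: "e1 > 0" "ball z e1 \<subseteq> ball z0 r"
    using z open_contains_ball[of "ball z0 r"] by blast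
  obtain e2 where e2: "e2 > 0" "ball (\<omega> z) e2 \<subseteq> ball w0 \<epsilon>"
    using wz open_contains_ball[of "ball w0 \<epsilon>"] by blast
  have "h z' w' = 0" if "dist z' z < min e1 e2" "dist w' (\<omega> z) < min e1 e2" "w' \<in> W z'" for z' w'
  proof -
    have z': "z' \<in> ball z0 r"
      using e1(2) that(1) by (auto simp: dist_commute)
    have "w' \<in> ball w0 \<epsilon>"
      using e2(2) that(2) by (auto simp: dist_commute)
    hence "w' = \<omega> z'"
      using W[OF z'] that(3) by blast
    thus ?thesis using v z' by simp
  qed
  moreover have "min e1 e2 > 0" using e1 e2 by simp
  ultimately show "\<omega> z \<in> K z"
    unfolding K_def using wz(1) by blast
qed

text \<open>Whether a section lies in \<open>K\<close> does not depend on the base point in the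
  ball, so the bijections between the fibres \<open>W\<close> restrict to the fibres
  \<open>K\<close>.\<close>

lemma local_K:
  assumes "z0 \<notin> D"
  obtains r \<omega> where "r > 0" "ball z0 r \<inter> D = {}"
    "\<And>w. w \<in> K z0 \<Longrightarrow> \<omega> w holomorphic_on ball z0 r"
    "\<And>z. z \<in> ball z0 r \<Longrightarrow> inj_on (\<lambda>w. \<omega> w z) (K z0)"
    "\<And>z. z \<in> ball z0 r \<Longrightarrow> K z = (\<lambda>w. \<omega> w z) ` K z0"
proof -
  obtain r \<epsilon> \<omega> where r: "r > 0" "\<epsilon> > 0" "ball z0 r \<inter> D = {}"
    and hol: "\<And>w. w \<in> W z0 \<Longrightarrow> \<omega> w holomorphic_on ball z0 r" and base: "\<And>w. w \<in> W z0 \<Longrightarrow> \<omega> w z0 = w"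
    and uniq: "\<And>w z. w \<in> W z0 \<Longrightarrow> z \<in> ball z0 r \<Longrightarrow> W z \<inter> ball w \<epsilon> = {\<omega> w z}"
    and bij: "\<And>z. z \<in> ball z0 r \<Longrightarrow> bij_betw (\<lambda>w. \<omega> w z) (W z0) (W z)"
    using local_sections[OF assms] by blast
  have K: "\<omega> w z \<in> K z \<longleftrightarrow> w \<in> K z0" if w: "w \<in> W z0" and z: "z \<in> ball z0 r" for w z
    using section_in_K_iff[OF hol[OF w] uniq[OF w] z] section_in_K_iff[OF hol[OF w] uniq[OF w], of z0]
      r(1) base[OF w] by simp
  have "K z = (\<lambda>w. \<omega> w z) ` K z0" if z: "z \<in> ball z0 r" for z
  proof
    show "K z \<subseteq> (\<lambda>w. \<omega> w z) ` K z0"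
    proof
      fix v assume v: "v \<in> K z"
      hence "v \<in> (\<lambda>w. \<omega> w z) ` W z0"
        using bij[OF z] K_subset_W by (auto simp: bij_betw_def)
      then obtain w where w: "w \<in> W z0" "v = \<omega> w z" by blast
      thus "v \<in> (\<lambda>w. \<omega> w z) ` K z0" using K[OF w(1) z] v by blast
    qed
    show "(\<lambda>w. \<omega> w z) ` K z0 \<subseteq> K z"
      using K[OF _ z] K_subset_W by blast
  qed
  moreover have "inj_on (\<lambda>w. \<omega> w z) (K z0)" if z: "z \<in> ball z0 r" for z
    using bij[OF z] K_subset_W inj_on_subset by (metis bij_betw_def)
  ultimately show ?thesis
    using that[of r \<omega>] r hol K_subset_W by blast
qed

text \<open>By continuity \<open>\<phi>\<close> coincides near \<open>z0\<close>, on
  \<open>A\<close>, with the section through \<open>\<phi> z0\<close>. The zeros of \<open>h\<close>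
  along this section thus accumulate at \<open>z0\<close>.\<close>

lemma accumulation_in_K:
  assumes z0: "z0 \<notin> D" and lim: "z0 islimpt A" and cont: "isCont \<phi> z0" and "\<phi> z0 \<in> W z0"
    and A: "\<And>z. z \<in> A \<Longrightarrow> \<phi> z \<in> W z \<and> h z (\<phi> z) = 0"
  shows "\<phi> z0 \<in> K z0"
proof -
  define w where "w = \<phi> z0"
  have w: "w \<in> W z0" using assms w_def by simp
  obtain r \<epsilon> \<omega> where r: "r > 0" "\<epsilon> > 0"
    and hol: "\<omega> w holomorphic_on ball z0 r" and base: "\<omega> w z0 = w"
    and uniq: "\<And>z. z \<in> ball z0 r \<Longrightarrow> W z \<inter> ball w \<epsilon> = {\<omega> w z}"
    using local_sections[OF z0] w by metis
  have "(\<phi> \<longlongrightarrow> w) (nhds z0)"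
    using cont unfolding isCont_def tendsto_at_iff_tendsto_nhds w_def .
  hence "eventually (\<lambda>z. dist (\<phi> z) w < \<epsilon>) (nhds z0)"
    using r(2) by (rule tendstoD)
  moreover have "eventually (\<lambda>z. z \<in> ball z0 r) (nhds z0)"
    using r(1) by (intro eventually_nhds_in_open) auto
  ultimately have "eventually (\<lambda>z. z \<in> A \<longrightarrow> h z (\<omega> w z) = 0) (nhds z0)"
  proof eventually_elim
    case (elim z)
    show ?case
    proof
      assume "z \<in> A"
      hence "\<phi> z \<in> W z \<inter> ball w \<epsilon>"
        using A elim by (simp add: dist_commute)
      hence "\<phi> z = \<omega> w z" using uniq[OF elim(2)] by blast
      thus "h z (\<omega> w z) = 0" using A \<open>z \<in> A\<close> by metis
    qed
  qed
  then obtain S where S: "open S" "z0 \<in> S" "\<And>z. z \<in> S \<Longrightarrow> z \<in> A \<Longrightarrow> h z (\<omega> w z) = 0"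
    unfolding eventually_nhds by blast
  have lim': "z0 islimpt (A \<inter> (S \<inter> ball z0 r))"
    by (intro islimpt_Int_eventually[OF lim] eventually_at_in_open') (use S r(1) in auto)
  have hol': "(\<lambda>z. h z (\<omega> w z)) holomorphic_on ball z0 r"
    using hol by (intro h_holomorphic) auto
  have "h z (\<omega> w z) = 0" if "z \<in> ball z0 r" for z
    by (rule analytic_continuation[OF hol' open_ball connected_ball _ _ lim'])
       (use that S r(1) in auto)
  hence "\<omega> w z0 \<in> K z0"
    using section_in_K_iff[OF hol uniq, of z0] r(1) by auto
  thus ?thesis using base w_def by simp
qed

end

section \<open>Growth of the roots and their symmetric functions\<close>

context separable_curve
begin

text \<open>A Cauchy bound multiplied through by the leading coefficient, so that it stays
  polynomial in size near the zeros of \<open>lc\<close>. The factor 2 covers roots in the unit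
  disc.\<close>

definition root_bound where
  "root_bound z = 2 * norm (poly lc z) + (\<Sum>i<degree R. norm (poly (coeff R i) z))"

lemma poly_growth_root_bound: "poly_growth root_bound"
  unfolding root_bound_def
  by (intro poly_growth_add poly_growth_sum poly_growth_mult[of "\<lambda>_. 2"] poly_growth_const poly_growth_poly) auto

text \<open>When \<open>norm w > 1\<close>, isolate the leading term of the equation and divide by
  \<open>norm w ^ (n - 1)\<close>.\<close>

lemma norm_root_le:
  assumes z: "z \<notin> D" and w: "w \<in> W z"
  shows "norm (poly lc z) * (1 + norm w) \<le> root_bound z"
proof (cases "norm w \<le> 1")
  case True
  have "norm (poly lc z) * (1 + norm w) \<le> norm (poly lc z) * 2"
    using True by (intro mult_left_mono) auto
  also have "\<dots> \<le> root_bound z"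
    unfolding root_bound_def by (simp add: sum_nonneg)
  finally show ?thesis .
next
  case False
  hence w1: "norm w > 1" by simp
  define n where "n = degree R"
  have "n > 0"
  proof (rule ccontr)
    assume "\<not> n > 0"
    hence "W z = {}" using card_W[OF z] finite_W[OF z] n_def by simp
    thus False using w by simp
  qed
  have "0 = poly (slice R z) w" using w by (simp add: W_def)
  also have "\<dots> = (\<Sum>i\<le>n. poly (coeff R i) z * w ^ i)"
    by (subst poly_altdef) (simp add: degree_slice[OF z] n_def)
  also have "\<dots> = (\<Sum>i<n. poly (coeff R i) z * w ^ i) + poly lc z * w ^ n"
    by (simp add: lessThan_Suc_atMost[symmetric] lc_def n_def)
  finally have "poly lc z * w ^ n = - (\<Sum>i<n. poly (coeff R i) z * w ^ i)"
    by (simp add: eq_neg_iff_add_eq_0 add.commute)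
  hence "norm (poly lc z) * norm w ^ n = norm (\<Sum>i<n. poly (coeff R i) z * w ^ i)"
    by (metis norm_minus_cancel norm_mult norm_power)
  also have "\<dots> \<le> (\<Sum>i<n. norm (poly (coeff R i) z) * norm w ^ i)"
    by (rule order.trans[OF norm_sum]) (simp add: norm_mult norm_power)
  also have "\<dots> \<le> (\<Sum>i<n. norm (poly (coeff R i) z) * norm w ^ (n - 1))"
    using w1 by (intro sum_mono mult_left_mono power_increasing) auto
  finally have "(norm (poly lc z) * norm w) * norm w ^ (n - 1)
      \<le> (\<Sum>i<n. norm (poly (coeff R i) z)) * norm w ^ (n - 1)"
    using power_eq_if[of "norm w" n] \<open>n > 0\<close> by (simp add: sum_distrib_right mult.assoc)
  hence "norm (poly lc z) * norm w \<le> (\<Sum>i<n. norm (poly (coeff R i) z))"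
    by (rule mult_right_le_imp_le) (use w1 in \<open>intro zero_less_power, linarith\<close>)
  thus ?thesis
    by (simp add: root_bound_def n_def distrib_left add_increasing)
qed

text \<open>Each root in \<open>I\<close> absorbs one factor \<open>lc\<close>, and the surplus
  factors are themselves below \<open>root_bound\<close>. Hence the exponent does not depend on the
  size of \<open>I\<close>.\<close>

lemma norm_scaled_coeff_le:
  assumes z: "z \<notin> D" and I: "I \<subseteq> W z"
  shows "norm (poly lc z ^ degree R * coeff (\<Prod>w\<in>I. [:- w, 1:]) j) \<le> root_bound z ^ degree R"
proof -
  have fin: "finite I" using I finite_W[OF z] finite_subset by blast
  have card: "card I \<le> degree R"
    using card_mono[OF finite_W[OF z] I] card_W[OF z] by simp
  have lcb: "norm (poly lc z) \<le> root_bound z"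
    unfolding root_bound_def by (simp add: sum_nonneg add_increasing2 add_nonneg_nonneg)
  hence rb: "0 \<le> root_bound z" using norm_ge_zero order.trans by blast
  have "norm (poly lc z ^ degree R * coeff (\<Prod>w\<in>I. [:- w, 1:]) j)
      \<le> norm (poly lc z) ^ degree R * (\<Prod>w\<in>I. 1 + norm w)"
    using norm_coeff_prod_roots_le[OF fin, of j] by (simp add: norm_mult norm_power mult_left_mono)
  also have "\<dots> = norm (poly lc z) ^ (degree R - card I) * (norm (poly lc z) ^ card I * (\<Prod>w\<in>I. 1 + norm w))"
    using card by (simp add: power_add[symmetric] mult.assoc[symmetric])
  also have "norm (poly lc z) ^ card I * (\<Prod>w\<in>I. 1 + norm w) = (\<Prod>w\<in>I. norm (poly lc z) * (1 + norm w))"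
    by (simp add: prod.distrib)
  also have "(\<Prod>w\<in>I. norm (poly lc z) * (1 + norm w)) \<le> (\<Prod>w\<in>I. root_bound z)"
    using I norm_root_le[OF z] by (intro prod_mono) (auto intro!: mult_nonneg_nonneg add_nonneg_nonneg)
  also have "(\<Prod>w\<in>I. root_bound z) = root_bound z ^ card I" by simp
  also have "norm (poly lc z) ^ (degree R - card I) * root_bound z ^ card I
      \<le> root_bound z ^ (degree R - card I) * root_bound z ^ card I"
    using lcb rb by (intro mult_right_mono power_mono) auto
  also have "\<dots> = root_bound z ^ degree R"
    using card by (simp add: power_add[symmetric])
  finally show ?thesis by (simp add: mult_left_mono)
qed

end

context vanishing_branches
begin

lemma finite_K: "z \<notin> D \<Longrightarrow> finite (K z)"
  using finite_W K_subset_W finite_subset by metis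

text \<open>Locally the product over \<open>K z\<close> can be reindexed by the fixed set
  \<open>K z0\<close> using holomorphic sections.\<close>

lemma coeff_K_holomorphic: "(\<lambda>z. coeff (\<Prod>w\<in>K z. [:- w, 1:]) j) holomorphic_on -D"
proof -
  have "(\<lambda>z. coeff (\<Prod>w\<in>K z. [:- w, 1:]) j) field_differentiable (at z0)" if z0: "z0 \<notin> D" for z0
  proof -
    obtain r \<omega> where r: "r > 0" "ball z0 r \<inter> D = {}"
      and hol: "\<And>w. w \<in> K z0 \<Longrightarrow> \<omega> w holomorphic_on ball z0 r"
      and inj: "\<And>z. z \<in> ball z0 r \<Longrightarrow> inj_on (\<lambda>w. \<omega> w z) (K z0)"
      and K: "\<And>z. z \<in> ball z0 r \<Longrightarrow> K z = (\<lambda>w. \<omega> w z) ` K z0"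
      using local_K[OF z0] by blast
    have "(\<lambda>z. coeff (\<Prod>w\<in>K z0. [:- \<omega> w z, 1:]) j) holomorphic_on ball z0 r"
      using finite_K[OF z0] hol by (rule holomorphic_on_coeff_prod_roots)
    also have "?this \<longleftrightarrow> (\<lambda>z. coeff (\<Prod>w\<in>K z. [:- w, 1:]) j) holomorphic_on ball z0 r"
    proof (intro holomorphic_cong refl)
      fix z assume z: "z \<in> ball z0 r"
      show "coeff (\<Prod>w\<in>K z0. [:- \<omega> w z, 1:]) j = coeff (\<Prod>w\<in>K z. [:- w, 1:]) j"
        unfolding K[OF z] prod.reindex[OF inj[OF z]] by simp
    qed
    finally show ?thesis
      using r(1) by (auto simp: holomorphic_on_open field_differentiable_def)
  qed
  thus ?thesis
    by (auto simp: holomorphic_on_def intro: field_differentiable_at_within)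
qed

text \<open>The power of \<open>lc\<close> controls growth near \<open>D\<close> and turns the
  symmetric functions into polynomials \<open>p j\<close>, the coefficients of \<open>B\<close>. Off
  \<open>D\<close> this power is nonzero, so no roots are added or lost.\<close>

lemma vanishing_branches_algebraic:
  obtains B where "\<And>z w. z \<notin> D \<Longrightarrow> eval2 B z w = 0 \<longleftrightarrow> w \<in> K z"
proof -
  define n where "n = degree R"
  have "\<exists>p. \<forall>z. z \<notin> D \<longrightarrow> poly lc z ^ n * coeff (\<Prod>w\<in>K z. [:- w, 1:]) j = poly p z" for j
  proof -
    have hol: "(\<lambda>z. poly lc z ^ n * coeff (\<Prod>w\<in>K z. [:- w, 1:]) j) holomorphic_on -D"
      by (intro holomorphic_intros coeff_K_holomorphic)
    have rb: "root_bound z \<ge> 0" for z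
      by (simp add: root_bound_def sum_nonneg)
    have "poly_growth (\<lambda>z. root_bound z ^ n)"
      by (intro poly_growth_power poly_growth_root_bound rb)
    from poly_growth_imp_polynomial[OF finite_D hol this]
    obtain p where "\<And>z. z \<notin> D \<Longrightarrow> poly lc z ^ n * coeff (\<Prod>w\<in>K z. [:- w, 1:]) j = poly p z"
      using norm_scaled_coeff_le[OF _ K_subset_W] n_def by metis
    thus ?thesis by blast
  qed
  then obtain p where p: "\<And>j z. z \<notin> D \<Longrightarrow> poly lc z ^ n * coeff (\<Prod>w\<in>K z. [:- w, 1:]) j = poly (p j) z"
    by metis
  define B where "B = (\<Sum>j\<le>n. monom (p j) j)"
  have "eval2 B z w = 0 \<longleftrightarrow> w \<in> K z" if z: "z \<notin> D" for z w
  proof -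
    define q where "q = (\<Prod>w\<in>K z. [:- w, 1:])"
    have "degree q = card (K z)"
      unfolding q_def by (subst degree_prod_eq_sum_degree) auto
    hence deg: "degree q \<le> n"
      using card_mono[OF finite_W[OF z] K_subset_W] card_W[OF z] n_def by simp
    have "slice B z = (\<Sum>j\<le>n. monom (poly (p j) z) j)"
      by (rule poly_eqI) (simp add: B_def coeff_sum if_distrib[of "\<lambda>p. poly p z"] cong: if_cong)
    also have "\<dots> = (\<Sum>j\<le>n. smult (poly lc z ^ n) (monom (coeff q j) j))"
      by (simp add: p[OF z, symmetric] q_def smult_monom)
    also have "\<dots> = smult (poly lc z ^ n) q"
      by (subst (2) poly_as_sum_of_monoms'[OF deg, symmetric])
         (rule poly_eqI, simp add: coeff_sum sum_distrib_left[symmetric])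
    finally have "slice B z = smult (poly lc z ^ n) q" .
    hence "eval2 B z w = poly lc z ^ n * poly q w"
      by (metis poly_slice poly_smult)
    moreover have "poly q w = 0 \<longleftrightarrow> w \<in> K z"
      using finite_K[OF z] by (auto simp: q_def poly_prod)
    ultimately show ?thesis
      using lc_nonzero[OF z] by simp
  qed
  thus ?thesis using that by blast
qed

end

text \<open>Since \<open>A\<close> has no isolated points, \<open>cnj z\<close> lies in
  \<open>K z\<close> for \<open>z\<close> in \<open>A - D\<close>. The polynomial \<open>B\<close>
  therefore vanishes at infinitely many real points of the irreducible curve, hence on all of its
  complexification, which puts every branch into \<open>K\<close> off \<open>D\<close>.\<close>

lemma vanishing_spreads:
  assumes "irreducible P" "A \<subseteq> zero_set2 P" "A \<noteq> {}" "\<And>z. z \<in> A \<Longrightarrow> z islimpt A"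
    and hol: "\<And>S \<omega>. open S \<Longrightarrow> \<omega> holomorphic_on S \<Longrightarrow> (\<lambda>z. h z (\<omega> z)) holomorphic_on S"
    and zero: "\<And>z. z \<in> A \<Longrightarrow> h z (cnj z) = 0"
  obtains D where "finite D" "\<And>z w. z \<notin> D \<Longrightarrow> schwarz_poly P z w = 0 \<Longrightarrow> h z w = 0"
proof -
  have "P \<noteq> 0" using assms(1) by auto
  obtain Q where Q: "\<And>z w. schwarz_poly P z w = eval2 Q z w"
    by (rule schwarz_poly_eval2) blast
  have "Q \<noteq> 0" using schwarz_eval2_nonzero[OF \<open>P \<noteq> 0\<close> Q] .
  then obtain R U V d where R: "R \<noteq> 0" "\<And>z w. eval2 Q z w = 0 \<Longrightarrow> eval2 R z w = 0"
    "[:d:] = U * R + V * pderiv R" "d \<noteq> 0"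
    by (rule separable_model) blast
  interpret vanishing_branches R U V d h
    by standard (use R hol in auto)
  obtain B where B: "\<And>z w. z \<notin> D \<Longrightarrow> eval2 B z w = 0 \<longleftrightarrow> w \<in> K z"
    by (rule vanishing_branches_algebraic) blast
  have AW: "cnj z \<in> W z" if "z \<in> A" for z
  proof -
    have "schwarz_poly P z (cnj z) = 0"
      using that assms(2) by (auto simp: schwarz_poly_cnj zero_set2_def)
    thus ?thesis using Q R(2) by (simp add: W_def)
  qed
  have "infinite A"
    using assms(3,4) islimpt_finite by blast
  hence "infinite (A - D)" using finite_D by simp
  moreover have "A - D \<subseteq> zero_set2 P" using assms(2) by blast
  moreover have "eval2 B z (cnj z) = 0" if z: "z \<in> A - D" for z
  proof -
    have "cnj z \<in> K z"
      using accumulation_in_K[of z A cnj] z assms(4) AW zero by (auto intro: continuous_intros)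
    thus ?thesis using B z by blast
  qed
  ultimately have "eval2 B z w = 0" if "schwarz_poly P z w = 0" for z w
    using vanishing_on_complexified_curve[OF assms(1)] that by blast
  hence "h z w = 0" if "z \<notin> D" "schwarz_poly P z w = 0" for z w
    using B K_vanishes that by blast
  thus ?thesis using that[OF finite_D] by blast
qed

section \<open>Behaviour near infinity\<close>

text \<open>Otherwise the inverse of \<open>\<gamma>\<close> would embed a planar disc into the line.\<close>
lemma slit_complement_dense:
  assumes "slit \<gamma>" "open S" "S \<noteq> {}"
  obtains z where "z \<in> S" "z \<notin> \<gamma> ` {0..}"
proof (rule ccontr)
  assume "\<not> thesis"
  hence sub: "S \<subseteq> \<gamma> ` {0..}" using that by blast
  obtain z0 where "z0 \<in> S" using assms(3) by blast
  then obtain e where e: "e > 0" "ball z0 e \<subseteq> S"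
    using assms(2) open_contains_ball by blast
  obtain B where B: "\<And>z. z \<in> ball z0 e \<Longrightarrow> norm z \<le> B"
    using bounded_ball[of z0 e] unfolding bounded_iff by blast
  have "eventually (\<lambda>t. norm (\<gamma> t) \<ge> B + 1) at_top"
    using assms(1) unfolding slit_def filterlim_at_infinity[OF order_refl]
    by (metis filterlim_at_infinity_imp_norm_at_top filterlim_at_top assms(1) slit_def)
  then obtain T where T: "\<And>t. t \<ge> T \<Longrightarrow> norm (\<gamma> t) \<ge> B + 1"
    unfolding eventually_at_top_linorder by blast
  \<comment> \<open>After time \<open>T\<close> the slit has left the disc. On the remaining compact
    arc the inverse of \<open>\<gamma>\<close> is continuous.\<close>
  have sub': "ball z0 e \<subseteq> \<gamma> ` {0..T}"
  proof
    fix z assume z: "z \<in> ball z0 e"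
    hence "z \<in> \<gamma> ` {0..}" using sub e(2) by blast
    then obtain t where t: "t \<ge> 0" "z = \<gamma> t" by auto
    have "t \<le> T" using T[of t] B[OF z] t(2) by force
    thus "z \<in> \<gamma> ` {0..T}" using t by auto
  qed
  have inj: "inj_on \<gamma> {0..T}"
    using assms(1) by (auto simp: slit_def intro: inj_on_subset)
  have "continuous_on {0..T} \<gamma>"
    using assms(1) by (auto simp: slit_def intro: continuous_on_subset)
  hence "continuous_on (\<gamma> ` {0..T}) (inv_into {0..T} \<gamma>)"
    by (rule continuous_on_inv) (auto simp: inv_into_f_f[OF inj])
  hence "continuous_on (ball z0 e) (inv_into {0..T} \<gamma>)"
    using sub' by (rule continuous_on_subset)
  moreover have "inj_on (inv_into {0..T} \<gamma>) (ball z0 e)"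
    using sub' by (rule inj_on_inv_into)
  ultimately have "DIM(complex) \<le> DIM(real)"
    using e(1) by (intro invariance_of_dimension[of "ball z0 e"]) auto
  thus False by simp
qed

section \<open>Zeros of entire functions\<close>

text \<open>The local factorization bounds \<open>f / (z - z0) ^ n\<close> near \<open>z0\<close>,
  so the quotient extends to an entire function, whose value at \<open>z0\<close> is that of the
  nonvanishing local factor.\<close>

lemma entire_factor_zero:
  assumes hol: "f holomorphic_on UNIV" and nz: "f z1 \<noteq> 0"
  obtains n g where "g holomorphic_on UNIV" "g z0 \<noteq> 0" "\<And>z. f z = (z - z0) ^ n * g z"
proof (cases "f z0 = 0")
  case False
  thus ?thesis using that[of f 0] hol by simp
next
  case True
  hence "\<not> f constant_on UNIV"
    using nz by (metis UNIV_I constant_on_def)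
  then obtain g r n where g: "0 < n" "0 < r" "g holomorphic_on ball z0 r"
    "\<And>w. w \<in> ball z0 r \<Longrightarrow> f w = (w - z0) ^ n * g w" "\<And>w. w \<in> ball z0 r \<Longrightarrow> g w \<noteq> 0"
    using holomorphic_factor_zero_nonconstant[OF hol open_UNIV connected_UNIV UNIV_I True] by metis
  have "isCont g z0"
    using g(2) holomorphic_on_imp_continuous_on[OF g(3)] by (simp add: continuous_on_eq_continuous_at)
  hence lim: "(g \<longlongrightarrow> g z0) (at z0)" by (simp add: isCont_def)
  have "eventually (\<lambda>w. w \<in> ball z0 r \<and> w \<noteq> z0) (at z0)"
    using g(2) by (intro eventually_conj eventually_at_in_open') (auto simp: eventually_at_filter)
  hence ev: "eventually (\<lambda>w. f w / (w - z0) ^ n = g w) (at z0)"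
    by eventually_elim (use g(4) in auto)
  have "((\<lambda>w. norm (g w)) \<longlongrightarrow> norm (g z0)) (at z0)"
    by (intro tendsto_intros lim)
  hence "eventually (\<lambda>w. norm (g w) < norm (g z0) + 1) (at z0)"
    by (rule order_tendstoD(2)) simp
  with ev have "eventually (\<lambda>w. norm (f w / (w - z0) ^ n) \<le> norm (g z0) + 1) (at z0)"
    by eventually_elim simp
  moreover have "(\<lambda>w. f w / (w - z0) ^ n) holomorphic_on -{z0}"
    by (intro holomorphic_intros holomorphic_on_subset[OF hol]) auto
  ultimately obtain G where G: "G holomorphic_on UNIV" "\<And>z. z \<noteq> z0 \<Longrightarrow> G z = f z / (z - z0) ^ n"
    using holomorphic_extension_finite[of "{z0}" "\<lambda>w. f w / (w - z0) ^ n"] by auto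
  have "eventually (\<lambda>w. g w = G w) (at z0)"
    using ev unfolding eventually_at_filter by eventually_elim (auto simp: G(2))
  with lim have limG: "(G \<longlongrightarrow> g z0) (at z0)"
    by (rule Lim_transform_eventually)
  have "isCont G z0"
    using holomorphic_on_imp_continuous_on[OF G(1)] by (simp add: continuous_on_eq_continuous_at)
  hence "(G \<longlongrightarrow> G z0) (at z0)" by (simp add: isCont_def)
  hence "G z0 = g z0"
    using limG tendsto_unique[OF trivial_limit_at] by blast
  hence "G z0 \<noteq> 0" using g(2,5) by simp
  moreover have "f z = (z - z0) ^ n * G z" for z
    by (cases "z = z0") (use G(2) True g(1) in auto)
  ultimately show ?thesis using that G(1) by blast
qed

lemma entire_finite_zeros_factor:
  assumes "finite {z. f z = 0}" "f holomorphic_on UNIV"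
  obtains q g where "q \<noteq> 0" "g holomorphic_on UNIV" "\<And>z. g z \<noteq> 0" "\<And>z. f z = poly q z * g z"
proof -
  have "\<exists>q g. q \<noteq> 0 \<and> g holomorphic_on UNIV \<and> (\<forall>z. g z \<noteq> 0) \<and> (\<forall>z. f z = poly q z * g z)"
    if "finite Z" "{z. f z = 0} = Z" "f holomorphic_on UNIV" for Z f
    using that
  proof (induction Z arbitrary: f rule: finite_induct)
    case empty
    thus ?case by (intro exI[of _ 1] exI[of _ f]) auto
  next
    case (insert a Z)
    have "\<exists>z1. f z1 \<noteq> 0"
    proof (rule ccontr)
      assume "\<not> (\<exists>z1. f z1 \<noteq> 0)"
      hence "{z. f z = 0} = UNIV" by auto
      thus False using insert.prems(1) insert.hyps(1) infinite_UNIV_char_0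
        by (metis finite_insert)
    qed
    then obtain n g where g: "g holomorphic_on UNIV" "g a \<noteq> 0" "\<And>z. f z = (z - a) ^ n * g z"
      using entire_factor_zero[OF insert.prems(2)] by metis
    have n: "n > 0"
    proof (rule ccontr)
      assume "\<not> n > 0"
      hence "f a \<noteq> 0" using g(2) g(3)[of a] by simp
      thus False using insert.prems(1) by blast
    qed
    have "{z. g z = 0} = Z"
    proof -
      have "g z = 0 \<longleftrightarrow> f z = 0 \<and> z \<noteq> a" for z
        using g(2) g(3)[of z] n by (cases "z = a") auto
      thus ?thesis using insert.prems(1) insert.hyps(2) by auto
    qed
    from insert.IH[OF this g(1)] obtain q k where
      "q \<noteq> 0" "k holomorphic_on UNIV" "\<forall>z. k z \<noteq> 0" "\<forall>z. g z = poly q z * k z" by blast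
    thus ?case
      by (intro exI[of _ "[:-a, 1:] ^ n * q"] exI[of _ k]) (auto simp: g(3) mult_ac)
  qed
  thus ?thesis using assms that by blast
qed

text \<open>Take for \<open>m\<close> the least order at \<open>c\<close> among the
  \<open>H i\<close> that are not identically zero. The division keeps the limiting equation at
  \<open>w = c\<close> from becoming trivial.\<close>

lemma common_zero_factor:
  assumes fin: "finite I" and hol: "\<And>i. i \<in> I \<Longrightarrow> H i holomorphic_on UNIV"
    and nz: "i0 \<in> I" "H i0 z1 \<noteq> 0"
  obtains m G where "\<And>i. i \<in> I \<Longrightarrow> G i holomorphic_on UNIV"
    "\<And>i z. i \<in> I \<Longrightarrow> H i z = (z - c) ^ m * G i z" "\<exists>i\<in>I. G i c \<noteq> 0"
proof -
  define J where "J = {i \<in> I. \<exists>z. H i z \<noteq> 0}"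
  have J: "finite J" "J \<noteq> {}" "J \<subseteq> I" using fin nz by (auto simp: J_def)
  have "\<forall>i\<in>J. \<exists>n g. g holomorphic_on UNIV \<and> g c \<noteq> 0 \<and> (\<forall>z. H i z = (z - c) ^ n * g z)"
  proof
    fix i assume "i \<in> J"
    then obtain z where "H i z \<noteq> 0" "i \<in> I" by (auto simp: J_def)
    thus "\<exists>n g. g holomorphic_on UNIV \<and> g c \<noteq> 0 \<and> (\<forall>z. H i z = (z - c) ^ n * g z)"
      using entire_factor_zero[OF hol, of i z c] by metis
  qed
  then obtain n g where g: "\<And>i. i \<in> J \<Longrightarrow> g i holomorphic_on UNIV" "\<And>i. i \<in> J \<Longrightarrow> g i c \<noteq> 0"
    "\<And>i z. i \<in> J \<Longrightarrow> H i z = (z - c) ^ n i * g i z"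
    by metis
  define m where "m = Min (n ` J)"
  have m: "m \<le> n i" if "i \<in> J" for i
    using J that by (simp add: m_def)
  define G where "G i z = (if i \<in> J then (z - c) ^ (n i - m) * g i z else 0)" for i z
  have "m \<in> n ` J" unfolding m_def using J by (intro Min_in) auto
  then obtain i where "i \<in> J" "n i = m" by auto
  hence "\<exists>i\<in>I. G i c \<noteq> 0"
    using J(3) g(2) by (auto simp: G_def intro!: bexI[of _ i])
  moreover have "G i holomorphic_on UNIV" for i
    unfolding G_def using g(1) by (cases "i \<in> J") (auto intro!: holomorphic_intros)
  moreover have "H i z = (z - c) ^ m * G i z" if "i \<in> I" for i z
  proof (cases "i \<in> J")
    case True
    thus ?thesis using m[OF True]
      by (simp add: G_def g(3) mult.assoc[symmetric] power_add[symmetric])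
  next
    case False
    thus ?thesis using that by (auto simp: G_def J_def)
  qed
  ultimately show ?thesis using that by blast
qed

text \<open>A quotient \<open>a / b\<close> that omits a disc near infinity: after moving the centre of the disc to infinity
  there are only finitely many poles, and Liouville's theorem applies.\<close>
lemma omits_disc_imp_rational:
  assumes a: "a holomorphic_on UNIV" and b: "b holomorphic_on UNIV"
    and no_common: "\<And>z. a z = 0 \<Longrightarrow> b z \<noteq> 0" and nz: "b z1 \<noteq> 0"
    and \<epsilon>: "\<epsilon> > 0" and far: "\<And>z. norm z > r \<Longrightarrow> norm (a z - u0 * b z) \<ge> \<epsilon> * norm (b z)"
  obtains p q where "q \<noteq> 0" "\<And>z. b z \<noteq> 0 \<Longrightarrow> poly q z \<noteq> 0 \<Longrightarrow> a z / b z = poly p z / poly q z"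
proof -
  define e where "e z = a z - u0 * b z" for z
  have e: "e holomorphic_on UNIV"
    unfolding e_def by (intro holomorphic_intros a b)
  have e_far: "e z \<noteq> 0" if "norm z > r" for z
  proof
    assume "e z = 0"
    hence "b z = 0" using far[OF that] \<epsilon> by (simp add: e_def mult_le_0_iff)
    thus False using \<open>e z = 0\<close> no_common by (auto simp: e_def)
  qed
  \<comment> \<open>A point outside the disc, also for negative \<open>r\<close>, which shows that
    \<open>e\<close> is not identically zero.\<close>
  have far_pt: "norm (of_real (max r 0 + 1) :: complex) > r"
    unfolding norm_of_real by linarith
  have "finite {z. e z = 0}"
  proof (rule ccontr)
    assume inf: "infinite {z. e z = 0}"
    have "{z. e z = 0} \<subseteq> cball 0 r"
      using e_far by (force simp: not_le[symmetric])
    hence "\<exists>\<xi>\<in>cball 0 r. \<xi> islimpt {z. e z = 0}"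
      using inf compact_cball Heine_Borel_imp_Bolzano_Weierstrass by blast
    then obtain \<xi> where lim: "\<xi> islimpt {z. e z = 0}" by blast
    have "e (of_real (max r 0 + 1)) = 0"
      by (rule analytic_continuation[OF e open_UNIV connected_UNIV _ _ lim]) auto
    thus False using e_far far_pt by blast
  qed
  then obtain q g where q: "q \<noteq> 0" and g: "g holomorphic_on UNIV" "\<And>z. g z \<noteq> 0"
    and eqg: "\<And>z. e z = poly q z * g z"
    using entire_finite_zeros_factor[OF _ e] by metis
  \<comment> \<open>Here \<open>k = q * (b / e)\<close> wherever \<open>e\<close> is nonzero, and
    \<open>b / e\<close> is bounded by \<open>1 / \<epsilon>\<close> far out, so \<open>k\<close>
    grows no faster than \<open>q\<close>.\<close>
  define k where "k z = b z / g z" for z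
  have k: "k holomorphic_on UNIV"
    unfolding k_def using g by (intro holomorphic_intros b) auto
  have "compact (k ` cball 0 r)"
    by (intro compact_continuous_image compact_cball holomorphic_on_imp_continuous_on
        holomorphic_on_subset[OF k] subset_UNIV)
  hence "bounded (k ` cball 0 r)" by (rule compact_imp_bounded)
  then obtain B where B: "\<And>z. z \<in> cball 0 r \<Longrightarrow> norm (k z) \<le> B"
    unfolding bounded_iff by blast
  have bound: "norm (k z) \<le> \<bar>B\<bar> + 1 / \<epsilon> * norm (poly q z)" for z
  proof (cases "norm z > r")
    case True
    have "\<epsilon> * norm (b z) \<le> norm (poly q z) * norm (g z)"
      using far[OF True] eqg[of z] by (simp add: e_def norm_mult)
    hence "norm (k z) \<le> 1 / \<epsilon> * norm (poly q z)"
      using \<epsilon> g(2)[of z] by (simp add: k_def norm_divide field_simps)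
    thus ?thesis by linarith
  next
    case False
    hence "norm (k z) \<le> B" using B by simp
    thus ?thesis using \<epsilon> by (intro order.trans[OF _ add_increasing2[OF _ abs_ge_self]]) auto
  qed
  have "poly_growth (\<lambda>z. \<bar>B\<bar> + 1 / \<epsilon> * norm (poly q z))"
    using \<epsilon> by (intro poly_growth_add poly_growth_mult poly_growth_const poly_growth_poly) auto
  from poly_growth_imp_polynomial[OF finite.emptyI _ this, of k] k bound
  obtain p where p: "\<And>z. k z = poly p z" by auto
  have bp: "b z = poly p z * g z" for z
    using p[of z] g(2)[of z] by (simp add: k_def field_simps)
  have "p \<noteq> 0" using nz bp[of z1] by auto
  moreover have "a z / b z = poly (q + smult u0 p) z / poly p z" if "b z \<noteq> 0" for z
  proof -
    have "a z = (poly q z + u0 * poly p z) * g z"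
      using eqg[of z] bp[of z] by (simp add: e_def algebra_simps)
    thus ?thesis using g(2)[of z] bp[of z] by simp
  qed
  ultimately show ?thesis using that by blast
qed

section \<open>Quotients of entire functions and cleared denominators\<close>

text \<open>Weierstrass factorization applies once removable singularities are filled in, which
  changes no value at a point of analyticity. Numerator and denominator vanish at the zeros and at
  the poles respectively, so they share no zero.\<close>

lemma meromorphic_quotient_of_entire:
  assumes "f meromorphic_on UNIV"
  obtains a b where "a holomorphic_on UNIV" "b holomorphic_on UNIV" "\<And>z. a z = 0 \<Longrightarrow> b z \<noteq> 0"
    "\<And>z. f analytic_on {z} \<Longrightarrow> b z \<noteq> 0 \<and> f z = a z / b z"
proof -
  obtain h f1 f2 where *: "h holomorphic_on UNIV" "f1 holomorphic_on UNIV" "f2 holomorphic_on UNIV"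
    "\<forall>z. f1 z = 0 \<longleftrightarrow> \<not>is_pole (remove_sings f) z \<and> remove_sings f z = 0"
    "\<forall>z. f2 z = 0 \<longleftrightarrow> is_pole (remove_sings f) z"
    "\<forall>z. h z \<noteq> 0" "\<forall>z. remove_sings f z = h z * f1 z / f2 z"
    using weierstrass_factorization_meromorphic_UNIV[OF remove_sings_nicely_meromorphic[OF assms]]
    by metis
  show ?thesis
  proof (rule that[of "\<lambda>z. h z * f1 z" f2])
    show "(\<lambda>z. h z * f1 z) holomorphic_on UNIV" by (intro holomorphic_intros *)
    show "f2 holomorphic_on UNIV" by fact
    show "f2 z \<noteq> 0" if "h z * f1 z = 0" for z
      using that *(4,5,6) by (metis mult_eq_0_iff)
    show "f2 z \<noteq> 0 \<and> f z = h z * f1 z / f2 z" if "f analytic_on {z}" for z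
    proof
      have "remove_sings f analytic_on {z}"
        using that by (rule remove_sings_analytic_on)
      thus "f2 z \<noteq> 0"
        using *(5) analytic_at_imp_no_pole by blast
      show "f z = h z * f1 z / f2 z"
        using *(7) remove_sings_at_analytic[OF that] by metis
    qed
  qed
qed

text \<open>A common bound \<open>M\<close> on the inner degrees makes the double sum rectangular,
  so that it can be regrouped by powers of \<open>u\<close>.\<close>

lemma eval2_as_sum:
  assumes "\<And>j. degree (coeff Q j) \<le> M"
  shows "eval2 Q u v = (\<Sum>j\<le>degree Q. \<Sum>i\<le>M. coeff (coeff Q j) i * u ^ i * v ^ j)"
proof -
  have p: "poly (coeff Q j) u = (\<Sum>i\<le>M. coeff (coeff Q j) i * u ^ i)" for j
  proof -
    have "poly (coeff Q j) u = poly (\<Sum>i\<le>M. monom (coeff (coeff Q j) i) i) u"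
      using assms by (simp add: poly_as_sum_of_monoms')
    thus ?thesis by (simp add: poly_sum poly_monom)
  qed
  have "Q = (\<Sum>j\<le>degree Q. monom (coeff Q j) j)"
    by (simp add: poly_as_sum_of_monoms)
  hence "eval2 Q u v = poly (poly (\<Sum>j\<le>degree Q. monom (coeff Q j) j) [:v:]) u"
    by (simp add: eval2_def)
  also have "\<dots> = (\<Sum>j\<le>degree Q. poly (coeff Q j) u * v ^ j)"
    by (simp add: poly_sum poly_monom)
  finally show ?thesis
    by (simp add: p sum_distrib_right)
qed

lemma eval2_homogenize:
  fixes Q :: "'a::field poly poly"
  assumes deg: "\<And>j. degree (coeff Q j) \<le> M" and "b \<noteq> 0" "b' \<noteq> 0"
  shows "eval2 Q (a / b) (a' / b') * b ^ M * b' ^ degree Q =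
    (\<Sum>i\<le>M. a ^ i * b ^ (M - i) * (\<Sum>j\<le>degree Q. coeff (coeff Q j) i * a' ^ j * b' ^ (degree Q - j)))"
proof -
  have clear: "(x / y) ^ k * y ^ n = x ^ k * y ^ (n - k)" if "y \<noteq> 0" "k \<le> n" for x y :: 'a and k n
    using that by (simp add: power_divide power_diff)
  have "eval2 Q (a / b) (a' / b') * b ^ M * b' ^ degree Q =
     (\<Sum>j\<le>degree Q. \<Sum>i\<le>M. coeff (coeff Q j) i * ((a / b) ^ i * b ^ M) * ((a' / b') ^ j * b' ^ degree Q))"
    unfolding eval2_as_sum[OF deg] sum_distrib_right by (simp add: mult_ac)
  also have "\<dots> = (\<Sum>j\<le>degree Q. \<Sum>i\<le>M. coeff (coeff Q j) i * (a ^ i * b ^ (M - i)) * (a' ^ j * b' ^ (degree Q - j)))"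
    by (intro sum.cong refl) (simp add: clear assms)
  also have "\<dots> = (\<Sum>i\<le>M. \<Sum>j\<le>degree Q. coeff (coeff Q j) i * (a ^ i * b ^ (M - i)) * (a' ^ j * b' ^ (degree Q - j)))"
    by (rule sum.swap)
  finally show ?thesis
    by (simp add: sum_distrib_left mult_ac)
qed

text \<open>The function \<open>T\<close> is continuous and nonzero at \<open>(c, u0)\<close>, hence
  nonzero near it. Far out and off the slit \<open>S z\<close> is close to \<open>c\<close> while
  \<open>T\<close> vanishes at \<open>(S z, a z / b z)\<close> wherever
  \<open>b z \<noteq> 0\<close>, so \<open>a z / b z\<close> avoids a disc around
  \<open>u0\<close>.\<close>

lemma omitted_disc:
  fixes G :: "nat \<Rightarrow> complex \<Rightarrow> complex"
  assumes slit: "slit \<gamma>" and lim: "(S \<longlongrightarrow> c) (inf at_infinity (principal (- (\<gamma> ` {0..}))))"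
    and G: "\<And>i. i \<le> M \<Longrightarrow> isCont (G i) c" and nz: "i0 \<le> M" "G i0 c \<noteq> 0"
    and cont: "continuous_on UNIV a" "continuous_on UNIV b"
    and D: "finite D" and zero: "\<And>z. z \<notin> D \<Longrightarrow> z \<notin> \<gamma> ` {0..} \<Longrightarrow> (\<Sum>i\<le>M. a z ^ i * b z ^ (M - i) * G i (S z)) = 0"
  obtains u0 \<epsilon> r where "\<epsilon> > 0" "\<And>z. norm z > r \<Longrightarrow> norm (a z - u0 * b z) \<ge> \<epsilon> * norm (b z)"
proof -
  define g where "g = (\<Sum>i\<le>M. monom (G i c) i)"
  have "coeff g i0 = G i0 c"
    using nz(1) by (simp add: g_def coeff_sum)
  hence "g \<noteq> 0" using nz(2) by auto
  then obtain u0 where u0: "poly g u0 \<noteq> 0"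
    using poly_all_0_iff_0 by blast
  define T where "T p = (\<Sum>i\<le>M. G i (fst p) * snd p ^ i)" for p
  have "T (c, u0) = poly g u0"
    by (simp add: T_def g_def poly_sum poly_monom)
  moreover have "(T \<longlongrightarrow> T (c, u0)) (nhds (c, u0))"
  proof -
    have "((\<lambda>p. G i (fst p)) \<longlongrightarrow> G i c) (nhds (c, u0))" if "i \<le> M" for i
    proof -
      have "(G i \<longlongrightarrow> G i c) (nhds c)"
        using G[OF that] unfolding isCont_def tendsto_at_iff_tendsto_nhds .
      moreover have "filterlim fst (nhds c) (nhds (c, u0))"
        using tendsto_fst[OF filterlim_ident, of "(c, u0)"] by simp
      ultimately show ?thesis by (rule filterlim_compose)
    qed
    moreover have "(snd \<longlongrightarrow> u0) (nhds (c, u0))"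
      using tendsto_snd[OF filterlim_ident, of "(c, u0)"] by simp
    ultimately show ?thesis
      unfolding T_def by (auto intro!: tendsto_intros)
  qed
  ultimately have "eventually (\<lambda>p. T p \<noteq> 0) (nhds c \<times>\<^sub>F nhds u0)"
    using u0 tendsto_imp_eventually_ne by (metis nhds_prod)
  then obtain Pf Pg where Pf: "eventually Pf (nhds c)" and Pg: "eventually Pg (nhds u0)"
    and PT: "\<And>w u. Pf w \<Longrightarrow> Pg u \<Longrightarrow> T (w, u) \<noteq> 0"
    unfolding eventually_prod_filter by blast
  obtain \<epsilon> where \<epsilon>: "\<epsilon> > 0" "\<And>u. dist u u0 < \<epsilon> \<Longrightarrow> Pg u"
    using Pg unfolding eventually_nhds_metric by blast
  have "eventually (\<lambda>z. Pf (S z)) (inf at_infinity (principal (- (\<gamma> ` {0..}))))"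
    using lim Pf by (simp add: filterlim_iff)
  hence "eventually (\<lambda>z. z \<notin> \<gamma> ` {0..} \<longrightarrow> Pf (S z)) at_infinity"
    by (simp add: eventually_inf_principal)
  then obtain r1 where r1: "\<And>z. norm z \<ge> r1 \<Longrightarrow> z \<notin> \<gamma> ` {0..} \<Longrightarrow> Pf (S z)"
    unfolding eventually_at_infinity by blast
  obtain r2 where r2: "\<And>z. z \<in> D \<Longrightarrow> norm z \<le> r2"
    using finite_imp_bounded[OF D] unfolding bounded_iff by blast
  define r where "r = max r1 r2"
  have off: "norm (a z - u0 * b z) \<ge> \<epsilon> * norm (b z)" if z: "norm z > r" "z \<notin> \<gamma> ` {0..}" for z
  proof (rule ccontr)
    assume neg: "\<not> norm (a z - u0 * b z) \<ge> \<epsilon> * norm (b z)"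
    have b0: "b z \<noteq> 0"
    proof
      assume "b z = 0"
      thus False using neg by simp
    qed
    have "norm (a z / b z - u0) = norm (a z - u0 * b z) / norm (b z)"
      using b0 by (simp add: norm_divide[symmetric] diff_divide_distrib)
    also have "\<dots> < \<epsilon>"
      using neg b0 by (simp add: divide_less_eq)
    finally have "Pg (a z / b z)"
      using \<epsilon>(2) by (simp add: dist_norm)
    moreover have "Pf (S z)" using r1 z by (simp add: r_def)
    ultimately have "T (S z, a z / b z) \<noteq> 0" by (rule PT[rotated])
    moreover have "b z ^ M * T (S z, a z / b z) = (\<Sum>i\<le>M. a z ^ i * b z ^ (M - i) * G i (S z))"
      unfolding T_def sum_distrib_left
      by (intro sum.cong refl) (use b0 in \<open>simp add: power_divide power_diff\<close>)
    moreover have "z \<notin> D" using r2[of z] z(1) by (auto simp: r_def)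
    ultimately show False
      using zero z(2) b0 by simp
  qed
  have "norm (a z - u0 * b z) \<ge> \<epsilon> * norm (b z)" if z: "norm z > r" for z
  proof (rule ccontr)
    assume neg: "\<not> norm (a z - u0 * b z) \<ge> \<epsilon> * norm (b z)"
    \<comment> \<open>With denominators cleared, failure of the inequality is an open condition, so
      a failure on the slit would also occur at some point off it.\<close>
    define N where "N = {z. r < norm z} \<inter> {z. norm (a z - u0 * b z) < \<epsilon> * norm (b z)}"
    have "open N"
      unfolding N_def by (intro open_Int open_Collect_less continuous_intros cont)
    moreover have "z \<in> N" using z neg by (simp add: N_def)
    ultimately obtain z' where "z' \<in> N" "z' \<notin> \<gamma> ` {0..}"
      using slit_complement_dense[OF slit] by blast
    thus False using off[of z'] by (simp add: N_def)
  qed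
  thus ?thesis using that \<epsilon>(1) by blast
qed

section \<open>Rationality of the meromorphic function\<close>

theorem theorem2:
  fixes f :: "complex \<Rightarrow> complex" and P :: "real poly poly"
    and \<gamma> :: "real \<Rightarrow> complex" and S :: "complex \<Rightarrow> complex"
    and c :: complex and A C' :: "complex set"
  assumes "f meromorphic_on UNIV"
    and "irreducible P" and "nonconst2 P"
    and "slit \<gamma>" and "schwarz_branch P \<gamma> S"
    and "(S \<longlongrightarrow> c) (inf at_infinity (principal (- (\<gamma> ` {0..}))))"
    and "nondegenerate_continuum A" and "A \<subseteq> zero_set2 P"
    and "real_alg_curve C'"
    and "\<forall>z\<in>A. f analytic_on {z} \<longrightarrow> f z \<in> C'"
  shows "is_rational_fun f"
proof -
  obtain a b where a: "a holomorphic_on UNIV" and b: "b holomorphic_on UNIV"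
    and no_common: "\<And>z. a z = 0 \<Longrightarrow> b z \<noteq> 0"
    and fab: "\<And>z. f analytic_on {z} \<Longrightarrow> b z \<noteq> 0 \<and> f z = a z / b z"
    by (rule meromorphic_quotient_of_entire[OF assms(1)]) blast
  define X where "X = {z. \<not> f analytic_on {z}}"
  have A: "compact A" "connected A"
    using assms(7) by (auto simp: nondegenerate_continuum_def)
  have perfect: "z islimpt A" if "z \<in> A" for z
    using connected_imp_perfect[OF A(2) that] assms(7) by (auto simp: nondegenerate_continuum_def)
  \<comment> \<open>Singularities of a meromorphic function are sparse, so the compact
    \<open>A\<close> meets only finitely many of them.\<close>
  have "X sparse_in UNIV"
    using meromorphic_on_imp_analytic_cosparse[OF assms(1)] unfolding eventually_cosparse X_def .
  hence "X sparse_in A" by (rule sparse_in_subset) simp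
  hence finX: "finite (A \<inter> X)" using A(1) by (rule sparse_in_compact_finite)
  have perfect': "z islimpt (A - F)" if "z \<in> A" "finite F" for z F
  proof -
    have "z islimpt ((A - F) \<union> F)"
      by (rule islimpt_subset[OF perfect[OF that(1)]]) blast
    thus ?thesis unfolding islimpt_Un using islimpt_finite[OF that(2)] by blast
  qed
  obtain z0 where z0: "z0 \<in> A"
    using assms(7) by (auto simp: nondegenerate_continuum_def)
  have nonempty: "A - F \<noteq> {}" if "finite F" for F
    using perfect'[OF z0 that] by (metis islimpt_EMPTY)
  obtain z1 where z1: "z1 \<in> A" "z1 \<notin> X"
    using nonempty[OF finX] by blast
  have bz1: "b z1 \<noteq> 0" using fab z1 by (auto simp: X_def)
  \<comment> \<open>Both cases below end by exhibiting an omitted disc.\<close>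
  have rational: ?thesis
    if far: "\<epsilon> > 0" "\<And>z. norm z > r \<Longrightarrow> norm (a z - u0 * b z) \<ge> \<epsilon> * norm (b z)" for \<epsilon> r u0
  proof (rule omits_disc_imp_rational[OF a b no_common bz1 far])
    fix p q assume "q \<noteq> 0" and pq: "\<And>z. b z \<noteq> 0 \<Longrightarrow> poly q z \<noteq> 0 \<Longrightarrow> a z / b z = poly p z / poly q z"
    have "f z = poly p z / poly q z" if "f analytic_on {z}" "poly q z \<noteq> 0" for z
      using fab[OF that(1)] pq[OF _ that(2)] by simp
    with \<open>q \<noteq> 0\<close> show ?thesis unfolding is_rational_fun_def by blast
  qed

  obtain P' where P': "nonconst2 P'" "C' = zero_set2 P'"
    using assms(9) by (auto simp: real_alg_curve_def)
  have "P' \<noteq> 0" using P'(1) unfolding nonconst2_def by (metis pCons_0_0)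
  obtain Q where Q: "\<And>z w. schwarz_poly P' z w = eval2 Q z w"
    by (rule schwarz_poly_eval2) blast
  have "Q \<noteq> 0" using schwarz_eval2_nonzero[OF \<open>P' \<noteq> 0\<close> Q] .
  define N where "N = degree Q"
  define M where "M = Max ((\<lambda>j. degree (coeff Q j)) ` {..N})"
  have M: "degree (coeff Q j) \<le> M" for j
  proof (cases "j \<le> N")
    case True
    thus ?thesis by (simp add: M_def)
  next
    case False
    thus ?thesis by (simp add: N_def coeff_eq_0)
  qed
  \<comment> \<open>The reflected functions are entire, and \<open>cnj (f z)\<close> becomes their
    quotient at \<open>w = cnj z\<close>.\<close>
  define a' where "a' = (\<lambda>w. cnj (a (cnj w)))"
  define b' where "b' = (\<lambda>w. cnj (b (cnj w)))"
  have a': "a' holomorphic_on UNIV" and b': "b' holomorphic_on UNIV"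
    using holomorphic_on_compose_cnj_cnj[OF holomorphic_on_subset[OF a subset_UNIV] open_UNIV]
      holomorphic_on_compose_cnj_cnj[OF holomorphic_on_subset[OF b subset_UNIV] open_UNIV]
    unfolding a'_def b'_def o_def by blast+
  define H where "H i w = (\<Sum>j\<le>N. coeff (coeff Q j) i * a' w ^ j * b' w ^ (N - j))" for i w
  have H: "H i holomorphic_on UNIV" for i
    unfolding H_def by (intro holomorphic_intros a' b')
  show ?thesis
  proof (cases "\<exists>i\<le>M. \<exists>w. H i w \<noteq> 0")
    case False
    txt \<open>Then \<open>f\<close> takes only finitely many values.\<close>
    define i0 where "i0 = degree (lead_coeff Q)"
    define p where "p = (\<Sum>j\<le>N. monom (coeff (coeff Q j) i0) j)"
    have "coeff p N = lead_coeff (lead_coeff Q)"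
      by (simp add: p_def coeff_sum i0_def N_def)
    hence "p \<noteq> 0" using \<open>Q \<noteq> 0\<close> by auto
    hence "bounded {v. poly p v = 0}" by (intro finite_imp_bounded poly_roots_finite)
    then obtain B where B: "\<And>v. poly p v = 0 \<Longrightarrow> norm v \<le> B"
      unfolding bounded_iff by blast
    \<comment> \<open>Values of modulus at most \<open>B\<close> stay at distance at least 1 from
      the centre \<open>B + 1\<close>.\<close>
    have "norm (a z - of_real (B + 1) * b z) \<ge> 1 * norm (b z)" for z
    proof (cases "b z = 0")
      case False
      have "i0 \<le> M" using M by (simp add: i0_def)
      hence "H i0 (cnj z) = 0" using \<open>\<not> (\<exists>i\<le>M. \<exists>w. H i w \<noteq> 0)\<close> by blast
      moreover have "H i0 (cnj z) = cnj (b z) ^ N * poly p (cnj (a z) / cnj (b z))"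
        unfolding H_def p_def poly_sum poly_monom sum_distrib_left
        by (intro sum.cong refl) (use False in \<open>simp add: a'_def b'_def power_divide power_diff\<close>)
      ultimately have "norm (cnj (a z) / cnj (b z)) \<le> B"
        using False by (intro B) simp
      hence "norm (a z) \<le> B * norm (b z)"
        using False by (simp add: norm_divide divide_le_eq)
      moreover have "norm (of_real (B + 1) * b z) - norm (a z) \<le> norm (a z - of_real (B + 1) * b z)"
        by (metis norm_minus_commute norm_triangle_ineq2)
      moreover have "(B + 1) * norm (b z) \<le> norm (of_real (B + 1) * b z)"
        unfolding norm_mult norm_of_real by (intro mult_right_mono) auto
      ultimately show ?thesis by (simp add: distrib_right)
    qed simp
    thus ?thesis by (intro rational[of 1]) auto
  next
    case True
    then obtain i0 w0 where i0: "i0 \<in> {..M}" "H i0 w0 \<noteq> 0" by blast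
    obtain m G where G0: "\<And>i. i \<in> {..M} \<Longrightarrow> G i holomorphic_on UNIV"
      and HG0: "\<And>i z. i \<in> {..M} \<Longrightarrow> H i z = (z - c) ^ m * G i z" and Gc: "\<exists>i\<in>{..M}. G i c \<noteq> 0"
      by (rule common_zero_factor[where I = "{..M}" and H = H and c = c and ?i0.0 = i0 and ?z1.0 = w0])
         (use H i0 in auto)
    have G: "G i holomorphic_on UNIV" if "i \<le> M" for i using G0 that by simp
    have HG: "H i z = (z - c) ^ m * G i z" if "i \<le> M" for i z using HG0 that by simp
    from Gc obtain i1 where i1: "i1 \<le> M" "G i1 c \<noteq> 0" by blast
    define h where "h z w = (\<Sum>i\<le>M. a z ^ i * b z ^ (M - i) * G i w)" for z w
    have h_zero: "h z (cnj z) = 0" if z: "z \<in> A" "z \<notin> X" "z \<noteq> cnj c" for z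
    proof -
      have an: "f analytic_on {z}" using z(2) by (simp add: X_def)
      have fz: "b z \<noteq> 0" "f z = a z / b z" using fab[OF an] by auto
      have "f z \<in> zero_set2 P'" using assms(10) an z(1) P'(2) by blast
      hence "eval2 Q (f z) (cnj (f z)) = 0"
        by (simp add: Q[symmetric] schwarz_poly_cnj zero_set2_def)
      hence "0 = eval2 Q (a z / b z) (a' (cnj z) / b' (cnj z)) * b z ^ M * b' (cnj z) ^ degree Q"
        using fz by (simp add: a'_def b'_def)
      also have "\<dots> = (\<Sum>i\<le>M. a z ^ i * b z ^ (M - i) * H i (cnj z))"
        unfolding H_def N_def by (rule eval2_homogenize[OF M]) (use fz in \<open>auto simp: b'_def\<close>)
      also have "\<dots> = (cnj z - c) ^ m * h z (cnj z)"
        unfolding h_def sum_distrib_left by (intro sum.cong refl) (simp add: HG)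
      finally show ?thesis using z(3) by auto
    qed
    \<comment> \<open>Besides the singularities of \<open>f\<close>, the point \<open>cnj c\<close>
      is removed, since the factor \<open>(cnj z - c) ^ m\<close> may vanish there.\<close>
    define F where "F = (A \<inter> X) \<union> {cnj c}"
    have F: "finite F" using finX by (simp add: F_def)
    have h_hol: "(\<lambda>z. h z (\<omega> z)) holomorphic_on U" if "open U" "\<omega> holomorphic_on U" for U \<omega>
    proof -
      have "(\<lambda>z. G i (\<omega> z)) holomorphic_on U" if "i \<le> M" for i
        using holomorphic_on_compose_gen[OF \<open>\<omega> holomorphic_on U\<close> G[OF that]] by (simp add: o_def)
      thus ?thesis
        unfolding h_def
        by (intro holomorphic_intros holomorphic_on_subset[OF a] holomorphic_on_subset[OF b]) auto
    qed
    have AF: "A - F \<subseteq> zero_set2 P" using assms(8) by blast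
    have limpt: "z islimpt (A - F)" if "z \<in> A - F" for z
      using perfect'[OF _ F] that by blast
    have h_AF: "h z (cnj z) = 0" if "z \<in> A - F" for z
      using h_zero that by (auto simp: F_def)
    obtain D where D: "finite D"
      and Dz: "\<And>z w. z \<notin> D \<Longrightarrow> schwarz_poly P z w = 0 \<Longrightarrow> h z w = 0"
      by (rule vanishing_spreads[where h = h, OF assms(2) AF nonempty[OF F] limpt h_hol h_AF]) blast+
    have hS: "(\<Sum>i\<le>M. a z ^ i * b z ^ (M - i) * G i (S z)) = 0" if "z \<notin> D" "z \<notin> \<gamma> ` {0..}" for z
      using Dz[OF that(1), of "S z"] assms(5) that(2) by (simp add: schwarz_branch_def h_def)
    have "isCont (G i) c" if "i \<le> M" for i
      using holomorphic_on_imp_continuous_on[OF G[OF that]] by (simp add: continuous_on_eq_continuous_at)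
    hence G_cont: "\<And>i. i \<le> M \<Longrightarrow> isCont (G i) c" .
    show ?thesis
      by (rule omitted_disc[where G = G and M = M and a = a and b = b, OF assms(4,6) G_cont i1 holomorphic_on_imp_continuous_on[OF a]
            holomorphic_on_imp_continuous_on[OF b] D hS rational])
  qed
qed

end
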